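(* For every integer $n\ge 2$, $$(x+1)^{n+1}A_{n-1}(x)-n\,x\,(x+1)^{n}A_{n-2}(x)=D_n(x^2)+\frac{1}{2x}\widetilde{B}_n(x^2).$$
   Context: For a finite Coxeter group $W$ with simple generators $s_1,\dots,s_n$, the length $\ell(\sigma)$ of $\sigma\in W$ is the number of generators in a reduced expression of $\sigma$; $i\in\{1,\dots,n\}$ is a descent of $\sigma$ if $\ell(\sigma s_i)<\ell(\sigma)$, and $\operatorname{des}\sigma$ is the number of descents. The Eulerian polynomial of $W$ is $W(x)=\sum_{\sigma\in W}x^{\operatorname{des}\sigma}$. $A_m(x)$ denotes the Eulerian polynomial of type $A_m$ (the symmetric group $S_{m+1}$ with adjacent transpositions), so $A_0(x)=1$ and $A_m(x)=\sum_{\sigma\in S_{m+1}}x^{|\{i:\sigma(i)>\sigma(i+1)\}|}$; $D_n(x)$ denotes the Eulerian polynomial of the Coxeter group of type $D_n$. For an irreducible finite Weyl group $W$ with simple reflections $s_1,\dots,s_n$, let $s_0$ be the reflection corresponding to the highest root; $i$ is an affine descent of $\sigma\in W$ if either $i=0$ and $\ell(\sigma s_0)>\ell(\sigma)$, or $1\le i\le n$ and $i$ is a descent of $\sigma$. Writing $\widetilde{\operatorname{des}}\,\sigma$ for the number of affine descents, the affine Eulerian polynomial is $\widetilde{W}(x)=\sum_{\sigma\in W}x^{\widetilde{\operatorname{des}}\,\sigma}$; $\widetilde{B}_n(x)$ denotes the affine Eulerian polynomial of the Weyl group of type $B_n$. *)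

theory Defs
  imports
    "HOL-Algebra.Sym_Groups"
    "HOL-Algebra.Elementary_Groups"
    "HOL-Computational_Algebra.Polynomial"
    "Jordan_Normal_Form.Matrix"
begin

section \<open>Length, descents and Eulerian polynomials\<close>

text \<open>
  A group \<open>G\<close> together with simple generators \<open>s 1, \<dots>, s n\<close>. The definitions below make sense for
  arbitrary generators; they are applied only to finite Coxeter groups.
\<close>

definition word_prod :: "('a, 'b) monoid_scheme \<Rightarrow> (nat \<Rightarrow> 'a) \<Rightarrow> nat list \<Rightarrow> 'a" where
  "word_prod G s w = foldr (\<lambda>i \<tau>. s i \<otimes>\<^bsub>G\<^esub> \<tau>) w \<one>\<^bsub>G\<^esub>"

definition coxeter_length :: "('a, 'b) monoid_scheme \<Rightarrow> (nat \<Rightarrow> 'a) \<Rightarrow> nat \<Rightarrow> 'a \<Rightarrow> nat" where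
  "coxeter_length G s n \<sigma> =
     (LEAST k. \<exists>w. length w = k \<and> set w \<subseteq> {1..n} \<and> word_prod G s w = \<sigma>)"

definition descents :: "('a, 'b) monoid_scheme \<Rightarrow> (nat \<Rightarrow> 'a) \<Rightarrow> nat \<Rightarrow> 'a \<Rightarrow> nat set" where
  "descents G s n \<sigma> =
     {i \<in> {1..n}. coxeter_length G s n (\<sigma> \<otimes>\<^bsub>G\<^esub> s i) < coxeter_length G s n \<sigma>}"

definition eulerian_poly ::
  "('a, 'b) monoid_scheme \<Rightarrow> (nat \<Rightarrow> 'a) \<Rightarrow> nat \<Rightarrow> 'c::comm_semiring_1 poly" where
  "eulerian_poly G s n = (\<Sum>\<sigma>\<in>carrier G. Polynomial.monom 1 (card (descents G s n \<sigma>)))"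

text \<open>
  For affine descents, \<open>s 0\<close> is in addition the reflection in the highest root. The length is still
  taken with respect to \<open>s 1, \<dots>, s n\<close> only, and the inequality for \<open>i = 0\<close> is reversed.
\<close>

definition affine_descents :: "('a, 'b) monoid_scheme \<Rightarrow> (nat \<Rightarrow> 'a) \<Rightarrow> nat \<Rightarrow> 'a \<Rightarrow> nat set" where
  "affine_descents G s n \<sigma> =
     {i. i = 0 \<and> coxeter_length G s n (\<sigma> \<otimes>\<^bsub>G\<^esub> s 0) > coxeter_length G s n \<sigma>}
     \<union> descents G s n \<sigma>"

definition affine_eulerian_poly ::
  "('a, 'b) monoid_scheme \<Rightarrow> (nat \<Rightarrow> 'a) \<Rightarrow> nat \<Rightarrow> 'c::comm_semiring_1 poly" where
  "affine_eulerian_poly G s n =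
     (\<Sum>\<sigma>\<in>carrier G. Polynomial.monom 1 (card (affine_descents G s n \<sigma>)))"


section \<open>Weyl groups\<close>

text \<open>
  Here \<open>\<alpha> 1, \<dots>, \<alpha> n\<close> are the simple roots of a crystallographic root system of rank \<open>n\<close>
  in \<open>\<real>\<^sup>n\<close>. Elements of the Weyl group are orthogonal \<open>n \<times> n\<close> matrices acting on column vectors.
\<close>

text \<open>The matrix of \<open>v \<mapsto> v - 2 (v \<bullet> a) / (a \<bullet> a) a\<close>.\<close>

definition reflection_mat :: "nat \<Rightarrow> real vec \<Rightarrow> real mat" where
  "reflection_mat n a = 1\<^sub>m n - mat n n (\<lambda>(i, j). 2 * (a $ i) * (a $ j) / (a \<bullet> a))"

definition general_linear_group :: "nat \<Rightarrow> real mat monoid" where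
  "general_linear_group n = units_of (ring_mat TYPE(real) n ())"

definition weyl_group :: "nat \<Rightarrow> (nat \<Rightarrow> real vec) \<Rightarrow> real mat monoid" where
  "weyl_group n \<alpha> =
     subgroup_generated (general_linear_group n) ((\<lambda>i. reflection_mat n (\<alpha> i)) ` {1..n})"

definition roots :: "nat \<Rightarrow> (nat \<Rightarrow> real vec) \<Rightarrow> real vec set" where
  "roots n \<alpha> = {\<sigma> *\<^sub>v \<alpha> i | \<sigma> i. \<sigma> \<in> carrier (weyl_group n \<alpha>) \<and> i \<in> {1..n}}"

text \<open>
  \<open>\<beta>\<close> lies below \<open>\<theta>\<close> in the root order if \<open>\<theta> - \<beta>\<close> is a sum of simple roots.
\<close>

definition root_le :: "nat \<Rightarrow> (nat \<Rightarrow> real vec) \<Rightarrow> real vec \<Rightarrow> real vec \<Rightarrow> bool" where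
  "root_le n \<alpha> \<beta> \<theta> \<longleftrightarrow>
     (\<exists>c :: nat \<Rightarrow> nat. \<forall>j<n. \<theta> $ j - \<beta> $ j = (\<Sum>i\<in>{1..n}. of_nat (c i) * \<alpha> i $ j))"

text \<open>Well defined only for irreducible root systems.\<close>

definition highest_root :: "nat \<Rightarrow> (nat \<Rightarrow> real vec) \<Rightarrow> real vec" where
  "highest_root n \<alpha> = (THE \<theta>. \<theta> \<in> roots n \<alpha> \<and> (\<forall>\<beta>\<in>roots n \<alpha>. root_le n \<alpha> \<beta> \<theta>))"

definition weyl_gen :: "nat \<Rightarrow> (nat \<Rightarrow> real vec) \<Rightarrow> nat \<Rightarrow> real mat" where
  "weyl_gen n \<alpha> i = reflection_mat n (if i = 0 then highest_root n \<alpha> else \<alpha> i)"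


section \<open>The types A, B and D\<close>

text \<open>
  Coordinates of vectors are indexed from 0, so \<open>unit_vec n (i - 1)\<close> is the standard basis vector
  \<open>e\<^sub>i\<close>, and the simple roots are the usual ones: \<open>e\<^sub>i - e\<^sub>i\<^sub>+\<^sub>1\<close> for \<open>1 \<le> i < n\<close>, followed by \<open>e\<^sub>n\<close>
  in type B and by \<open>e\<^sub>n\<^sub>-\<^sub>1 + e\<^sub>n\<close> in type D. Both are meant for \<open>n \<ge> 2\<close>; the small cases of type D are
  \<open>D\<^sub>2 = A\<^sub>1 \<times> A\<^sub>1\<close> and \<open>D\<^sub>3 = A\<^sub>3\<close>.
\<close>

definition simple_root_B :: "nat \<Rightarrow> nat \<Rightarrow> real vec" where
  "simple_root_B n i =
     (if i < n then unit_vec n (i - 1) - unit_vec n i else unit_vec n (n - 1))"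

definition simple_root_D :: "nat \<Rightarrow> nat \<Rightarrow> real vec" where
  "simple_root_D n i =
     (if i < n then unit_vec n (i - 1) - unit_vec n i
      else unit_vec n (n - 2) + unit_vec n (n - 1))"

definition eulerian_A :: "nat \<Rightarrow> 'c::comm_semiring_1 poly" where
  "eulerian_A m = eulerian_poly (sym_group (m + 1)) (\<lambda>i. transpose i (i + 1)) m"

definition eulerian_D :: "nat \<Rightarrow> 'c::comm_semiring_1 poly" where
  "eulerian_D n =
     eulerian_poly (weyl_group n (simple_root_D n)) (weyl_gen n (simple_root_D n)) n"

definition affine_eulerian_B :: "nat \<Rightarrow> 'c::comm_semiring_1 poly" where
  "affine_eulerian_B n =
     affine_eulerian_poly (weyl_group n (simple_root_B n)) (weyl_gen n (simple_root_B n)) n"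

end

theory Submission
  imports Defs
begin

text \<open>
  A signed permutation matrix \<open>\<sigma>\<close> is recorded by its word \<open>w = \<rho>\<^sup>T \<sigma>\<close> with \<open>\<rho> = (n, \<dots>, 1)\<close>, so that the
  sign of the root \<open>\<sigma> \<alpha>\<close> is the sign of \<open>w \<bullet> \<alpha>\<close> and descents become conditions on consecutive
  entries of \<open>w\<close>. Negating the entry \<open>\<plusminus>1\<close> does not affect type D descents, so \<open>2 D\<^sub>n\<close> is a sum
  over all signed words. Reversing and negating these words, the exponent of a word \<open>b\<close> in \<open>2 D\<^sub>n\<close> is
  \<open>asc(b) + [b\<^sub>1 + b\<^sub>2 > 0]\<close>; in the affine type B polynomial it has the further term \<open>[b\<^sub>n < 0]\<close>. Adding the two words that
  differ in the sign of \<open>b\<^sub>1\<close> replaces \<open>[b\<^sub>1 + b\<^sub>2 > 0]\<close> by \<open>[b\<^sub>1 > 0]\<close> at the cost of a sum over the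
  words \<open>b\<^sub>2 \<dots> b\<^sub>n\<close>. What remains are sums of \<open>y\<^bsup>asc\<^esup>\<close> over words with or without a zero attached
  at either end. Inserting the largest letter gives their recurrences, and these show that
  \<open>(x + 1)\<^bsup>n+1\<^esup> A\<^sub>n\<^sub>-\<^sub>1(x) = B\<^sub>n(x\<^sup>2) + 2\<^sup>n x A\<^sub>n\<^sub>-\<^sub>1(x\<^sup>2)\<close>.
\<close>

section \<open>Ascents of lists\<close>

text \<open>The arguments x^2 and the factor 1/(2x) come from a single weight. With y = x^2, 2x
  times the right-hand side is the sum over signed words b of y^(asc(b) + [b_1 + b_2 > 0]) (x +
  y^[b_n < 0]). Appending a zero to b absorbs the last exponent. Without the condition on b_1 + b_2
  the sum is therefore x 2^n A_{n-1}(y) + B_n(y), which is G_n = (x + 1)^(n+1) A_{n-1}(x). A zero in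
  front exchanges the roles: x B_n(y) + 2^n y A_{n-1}(y) = x G_n, precisely because y = x^2. The
  obstacle is [b_1 + b_2 > 0], which couples two letters. Trading it for [b_1 > 0] costs y times a
  sum over words with one letter less; the 2n choices of the lost letter make this 2n y G_{n-1}, and
  division by 2x leaves n x (x + 1)^n A_{n-2}(x). On the group side, length is defined through
  shortest words, so descents become accessible only after length is identified with a number of
  inversions.\<close>

fun ascents :: "'b::linorder list \<Rightarrow> nat" where
  "ascents (x # y # zs) = of_bool (x < y) + ascents (y # zs)"
| "ascents _ = 0"

lemma ascents_Cons: "xs \<noteq> [] \<Longrightarrow> ascents (x # xs) = of_bool (x < hd xs) + ascents xs"
  by (cases xs) auto

lemma ascents_snoc: "xs \<noteq> [] \<Longrightarrow> ascents (xs @ [x]) = ascents xs + of_bool (last xs < x)"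
  by (induction xs rule: ascents.induct) auto

lemma ascents_conv_card: "ascents xs = card {i. Suc i < length xs \<and> xs ! i < xs ! Suc i}"
proof (induction xs rule: ascents.induct)
  case (1 x y zs)
  let ?A = "{i. Suc i < length (y # zs) \<and> (y # zs) ! i < (y # zs) ! Suc i}"
  have "{i. Suc i < length (x # y # zs) \<and> (x # y # zs) ! i < (x # y # zs) ! Suc i}
      = (if x < y then {0} else {}) \<union> Suc ` ?A"
  proof (rule Set.set_eqI)
    fix i
    show "i \<in> {i. Suc i < length (x # y # zs) \<and> (x # y # zs) ! i < (x # y # zs) ! Suc i}
        \<longleftrightarrow> i \<in> (if x < y then {0} else {}) \<union> Suc ` ?A"
      by (cases i) auto
  qed
  moreover have "finite ?A" by (rule finite_subset[of _ "{..<length (y # zs)}"]) auto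
  ultimately show ?case using 1
    by (subst (asm) card_image[symmetric, of Suc]) (auto simp: card_insert_if)
qed auto

text \<open>Reversal and negation each turn ascents into descents, so together they preserve the
  count.\<close>

lemma ascents_map_uminus_rev:
  fixes xs :: "'b::linordered_ab_group_add list"
  shows "ascents (map uminus (rev xs)) = ascents xs"
proof (induction xs)
  case (Cons x xs)
  show ?case
  proof (cases "xs = []")
    case False
    then show ?thesis using Cons by (simp add: ascents_snoc ascents_Cons last_map last_rev)
  qed auto
qed auto

text \<open>For a largest \<open>M\<close> the count stays the same in front and inside an ascent,
  and grows by one in every other slot. For a smallest \<open>M\<close> the end takes over the role
  of the front. Either way there are \<open>ascents xs + 1\<close> neutral slots.\<close>

lemma sum_ascents_insert:
  fixes f :: "nat \<Rightarrow> 'a::comm_ring_1"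
  assumes "(\<forall>x\<in>set xs. x < M) \<or> (\<forall>x\<in>set xs. M < x)"
  shows "(\<Sum>k\<le>length xs. f (ascents (take k xs @ M # drop k xs)))
       = (of_nat (ascents xs) + 1) * f (ascents xs)
         + (of_nat (length xs) - of_nat (ascents xs)) * f (Suc (ascents xs))"
  using assms
proof (induction xs arbitrary: f rule: ascents.induct)
  case (1 x y zs)
  let ?a = "ascents (y # zs)"
  \<comment> \<open>With \<open>M\<close> behind \<open>y\<close>, the pair \<open>x\<close>,
    \<open>y\<close> contributes a fixed amount, which \<open>g\<close> absorbs. The induction
    hypothesis also counts \<open>M\<close> directly in front of \<open>y\<close>; this term is
    subtracted, because there \<open>M\<close> separates \<open>x\<close> from
    \<open>y\<close>.\<close>
  define g where "g = (\<lambda>a. f (of_bool (x < y) + a))"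
  have "(\<Sum>k\<le>length (y # zs). g (ascents (take k (y # zs) @ M # drop k (y # zs))))
      = (of_nat ?a + 1) * g ?a + (of_nat (length (y # zs)) - of_nat ?a) * g (Suc ?a)"
    using 1 by auto
  then have "g (ascents (M # y # zs))
        + (\<Sum>k\<le>length zs. g (ascents (y # take k zs @ M # drop k zs)))
      = (of_nat ?a + 1) * g ?a + (of_nat (length (y # zs)) - of_nat ?a) * g (Suc ?a)"
    by (simp add: sum.atMost_Suc_shift del: sum.atMost_Suc)
  then have *: "(\<Sum>k\<le>length zs. g (ascents (y # take k zs @ M # drop k zs)))
      = (of_nat ?a + 1) * g ?a + (of_nat (length (y # zs)) - of_nat ?a) * g (Suc ?a)
        - g (ascents (M # y # zs))"
    by (simp add: algebra_simps)
  have total: "(\<Sum>k\<le>length (x # y # zs). f (ascents (take k (x # y # zs) @ M # drop k (x # y # zs))))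
      = f (ascents (M # x # y # zs)) + f (ascents (x # M # y # zs))
        + (\<Sum>k\<le>length zs. g (ascents (y # take k zs @ M # drop k zs)))"
    by (simp add: sum.atMost_Suc_shift g_def del: sum.atMost_Suc)
  show ?case using 1(2) unfolding total * unfolding g_def
    by (auto simp: algebra_simps)
qed auto

text \<open>
  For \<open>\<kappa> = id\<close> these are the permutations of \<open>S\<close>, for \<open>\<kappa> = abs\<close> the signed permutations.
\<close>

definition keyed_lists :: "('b \<Rightarrow> 'c) \<Rightarrow> 'c set \<Rightarrow> 'b list set" where
  "keyed_lists \<kappa> S = {xs. distinct (map \<kappa> xs) \<and> \<kappa> ` set xs = S}"

lemma keyed_lists_length: "xs \<in> keyed_lists \<kappa> S \<Longrightarrow> length xs = card S"
  by (metis (mono_tags, lifting) distinct_card keyed_lists_def length_map list.set_map mem_Collect_eq)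

lemma keyed_lists_empty: "keyed_lists \<kappa> {} = {[]}"
  by (auto simp: keyed_lists_def)

lemma finite_keyed_lists:
  assumes "finite S" "\<And>M. M \<in> S \<Longrightarrow> finite (\<kappa> -` {M})"
  shows "finite (keyed_lists \<kappa> S)"
proof (rule finite_subset)
  show "keyed_lists \<kappa> S \<subseteq> {xs. set xs \<subseteq> (\<Union>M\<in>S. \<kappa> -` {M}) \<and> length xs = card S}"
    by (auto simp: keyed_lists_length) (auto simp: keyed_lists_def)
  show "finite \<dots>" using assms by (intro finite_lists_length_eq) auto
qed

lemma sum_keyed_lists_insert:
  fixes f :: "'b list \<Rightarrow> 'a::comm_monoid_add"
  assumes "finite S" "M \<in> S" "\<And>M. M \<in> S \<Longrightarrow> finite (\<kappa> -` {M})"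
  shows "(\<Sum>xs\<in>keyed_lists \<kappa> S. f xs)
    = (\<Sum>ys\<in>keyed_lists \<kappa> (S - {M}). \<Sum>v\<in>\<kappa> -` {M}. \<Sum>k\<le>length ys. f (take k ys @ v # drop k ys))"
proof -
  let ?A = "SIGMA ys:keyed_lists \<kappa> (S - {M}). (\<kappa> -` {M}) \<times> {..length ys}"
  let ?g = "\<lambda>(ys, v, k). take k ys @ v # drop k ys"
  have fin: "finite (keyed_lists \<kappa> (S - {M}))" "finite (\<kappa> -` {M})"
    using assms by (auto intro!: finite_keyed_lists)
  have bij: "bij_betw ?g ?A (keyed_lists \<kappa> S)"
    unfolding bij_betw_def
  proof (intro conjI inj_onI equalityI subsetI)
    fix p q assume p: "p \<in> ?A" and q: "q \<in> ?A" and eq: "?g p = ?g q"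
    obtain ys v k ys' v' k' where pq: "p = (ys, v, k)" "q = (ys', v', k')"
      by (metis prod_cases3)
    have *: "\<forall>u\<in>set ys. \<kappa> u \<noteq> M" "\<forall>u\<in>set ys'. \<kappa> u \<noteq> M" "\<kappa> v = M" "\<kappa> v' = M"
      "k \<le> length ys" "k' \<le> length ys'"
      using p q by (auto simp: pq keyed_lists_def)
    \<comment> \<open>The inserted letter is the only one with key \<open>M\<close>, so the list
      reveals where it was cut.\<close>
    have tw: "takeWhile (\<lambda>u. \<kappa> u \<noteq> M) (take j zs @ w # drop j zs) = take j zs"
      "dropWhile (\<lambda>u. \<kappa> u \<noteq> M) (take j zs @ w # drop j zs) = w # drop j zs"
      if "\<forall>u\<in>set zs. \<kappa> u \<noteq> M" "\<kappa> w = M" for j zs w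
    proof -
      have "\<forall>u\<in>set (take j zs). \<kappa> u \<noteq> M"
        using that by (auto dest: in_set_takeD)
      with that show "takeWhile (\<lambda>u. \<kappa> u \<noteq> M) (take j zs @ w # drop j zs) = take j zs"
        "dropWhile (\<lambda>u. \<kappa> u \<noteq> M) (take j zs @ w # drop j zs) = w # drop j zs"
        by (simp_all add: takeWhile_append2 dropWhile_append2)
    qed
    have "take k ys = take k' ys'" "v # drop k ys = v' # drop k' ys'"
      using tw[of ys v k] tw[of ys' v' k'] eq * by (auto simp: pq)
    moreover from this have "ys = ys'" by (metis append_take_drop_id list.inject)
    moreover have "k = k'" using \<open>take k ys = take k' ys'\<close> * by (metis length_take min.absorb2)
    ultimately show "p = q" by (simp add: pq)
  next
    fix xs assume "xs \<in> ?g ` ?A"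
    then obtain ys v k where *: "ys \<in> keyed_lists \<kappa> (S - {M})" "\<kappa> v = M"
      and xs: "xs = take k ys @ v # drop k ys" by auto
    have "mset ys = mset (take k ys) + mset (drop k ys)"
      by (metis append_take_drop_id mset_append)
    then have "mset (map \<kappa> xs) = mset (map \<kappa> (v # ys))"
      by (simp add: xs)
    then have "distinct (map \<kappa> xs) \<longleftrightarrow> distinct (map \<kappa> (v # ys))"
      "set (map \<kappa> xs) = set (map \<kappa> (v # ys))"
      by (metis mset_eq_imp_distinct_iff, metis mset_eq_setD)
    then show "xs \<in> keyed_lists \<kappa> S"
      using * assms by (auto simp: keyed_lists_def)
  next
    fix xs assume xs: "xs \<in> keyed_lists \<kappa> S"
    then obtain v where "v \<in> set xs" "\<kappa> v = M" using assms by (auto simp: keyed_lists_def)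
    then obtain us ws where split: "xs = us @ v # ws" by (metis split_list)
    have h: "(us @ ws, v, length us) \<in> ?A" "?g (us @ ws, v, length us) = xs"
      using xs \<open>\<kappa> v = M\<close> by (auto simp: split keyed_lists_def) (metis image_eqI)+
    show "xs \<in> ?g ` ?A" using imageI[OF h(1), of ?g] unfolding h(2) .
  qed
  have "sum f (keyed_lists \<kappa> S) = (\<Sum>p\<in>?A. f (?g p))"
    by (rule sum.reindex_bij_betw[OF bij, symmetric])
  also have "\<dots> = (\<Sum>ys\<in>keyed_lists \<kappa> (S - {M}). \<Sum>(v, k)\<in>(\<kappa> -` {M}) \<times> {..length ys}. f (take k ys @ v # drop k ys))"
    using fin assms(1) by (subst sum.Sigma) (simp_all add: case_prod_unfold)
  also have "\<dots> = (\<Sum>ys\<in>keyed_lists \<kappa> (S - {M}). \<Sum>v\<in>\<kappa> -` {M}. \<Sum>k\<le>length ys. f (take k ys @ v # drop k ys))"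
    by (intro sum.cong refl sum.cartesian_product[symmetric])
  finally show ?thesis .
qed

text \<open>Serves to remove a first letter on which the summand does not depend, so that
  \<open>M\<close> and \<open>v\<close> merely count.\<close>

lemma sum_keyed_lists_Cons:
  fixes f :: "'b list \<Rightarrow> 'a::comm_monoid_add"
  assumes "finite S" "S \<noteq> {}" "\<And>M. M \<in> S \<Longrightarrow> finite (\<kappa> -` {M})"
  shows "(\<Sum>xs\<in>keyed_lists \<kappa> S. f xs)
    = (\<Sum>M\<in>S. \<Sum>v\<in>\<kappa> -` {M}. \<Sum>ys\<in>keyed_lists \<kappa> (S - {M}). f (v # ys))"
proof -
  let ?A = "SIGMA M:S. (\<kappa> -` {M}) \<times> keyed_lists \<kappa> (S - {M})"
  let ?g = "\<lambda>(M, v, ys). v # ys"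
  have fin: "finite ((\<kappa> -` {M}) \<times> keyed_lists \<kappa> (S - {M}))" if "M \<in> S" for M
    using that assms by (intro finite_cartesian_product finite_keyed_lists) auto
  have bij: "bij_betw ?g ?A (keyed_lists \<kappa> S)"
    unfolding bij_betw_def
  proof (intro conjI inj_onI equalityI subsetI)
    fix xs assume xs: "xs \<in> keyed_lists \<kappa> S"
    then obtain v ys where split: "xs = v # ys" using assms(2) by (cases xs) (auto simp: keyed_lists_def)
    then have "(\<kappa> v, v, ys) \<in> ?A" using xs by (auto simp: keyed_lists_def) (metis image_eqI)
    then show "xs \<in> ?g ` ?A" using split by force
  next
    fix p q assume "p \<in> ?A" "q \<in> ?A" "?g p = ?g q"
    then show "p = q" by (cases p; cases q) auto
  next
    fix xs assume "xs \<in> ?g ` ?A"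
    then obtain v ys where xs: "xs = v # ys" "\<kappa> v \<in> S" "ys \<in> keyed_lists \<kappa> (S - {\<kappa> v})" by auto
    then have "distinct (map \<kappa> ys)" "\<kappa> ` set ys = S - {\<kappa> v}" by (simp_all add: keyed_lists_def)
    with xs show "xs \<in> keyed_lists \<kappa> S" by (auto simp: keyed_lists_def)
  qed
  have "sum f (keyed_lists \<kappa> S) = (\<Sum>p\<in>?A. f (?g p))"
    by (rule sum.reindex_bij_betw[OF bij, symmetric])
  also have "\<dots> = (\<Sum>M\<in>S. \<Sum>(v, ys)\<in>(\<kappa> -` {M}) \<times> keyed_lists \<kappa> (S - {M}). f (v # ys))"
    using fin assms(1) by (subst sum.Sigma) (simp_all add: case_prod_unfold)
  also have "\<dots> = (\<Sum>M\<in>S. \<Sum>v\<in>\<kappa> -` {M}. \<Sum>ys\<in>keyed_lists \<kappa> (S - {M}). f (v # ys))"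
    by (intro sum.cong refl sum.cartesian_product[symmetric])
  finally show ?thesis .
qed

section \<open>Recurrences for Eulerian polynomials\<close>

text \<open>
  Indexed by the number of letters: \<open>eulerian_rec m\<close> is \<open>A\<^sub>m\<^sub>-\<^sub>1\<close>.
\<close>

fun eulerian_rec :: "nat \<Rightarrow> 'a::field_char_0 poly" where
  "eulerian_rec 0 = 1"
| "eulerian_rec (Suc m) =
     [:1, of_nat m:] * eulerian_rec m + [:0, 1, -1:] * pderiv (eulerian_rec m)"

fun eulerian_rec_B :: "nat \<Rightarrow> 'a::field_char_0 poly" where
  "eulerian_rec_B 0 = 1"
| "eulerian_rec_B (Suc m) =
     [:1, of_nat (2 * m + 1):] * eulerian_rec_B m + 2 * [:0, 1, -1:] * pderiv (eulerian_rec_B m)"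

text \<open>The case a = b + 1 of \<open>pderiv_monom_ascents\<close>, with \<open>P\<close> for
  x^b, as a plain ring computation.\<close>

lemma ring_identity_monom: "(1 + b + 1) * (x * P) + (m - (1 + b)) * (x * (x * P))
    = (1 + m * x) * (x * P) + (x - x * x) * ((b + 1) * P)"
  for b m x P :: "'a::comm_ring_1"
  by (simp add: algebra_simps)

text \<open>Turns the slot count of \<open>sum_ascents_insert\<close> into an operator that is
  linear in the generating function: the factor a arises from differentiating x^a.\<close>

lemma pderiv_monom_ascents:
  fixes m :: nat
  shows "(of_nat a + 1) * Polynomial.monom 1 a + (of_nat m - of_nat a) * Polynomial.monom 1 (Suc a)
    = [:1, of_nat m:] * monom (1::'a::field_char_0) a + [:0, 1, -1:] * pderiv (Polynomial.monom 1 a)"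
proof -
  define x where "x = [:0, 1 :: 'a:]"
  have lin: "[:1, of_nat m:] = 1 + of_nat m * x" "[:0, 1, -1:] = x - x * x"
    by (simp_all add: x_def one_pCons of_nat_poly)
  have mon: "Polynomial.monom 1 (Suc b) = x * Polynomial.monom 1 b" for b
    by (simp add: x_def monom_Suc)
  show ?thesis
  proof (cases a)
    case 0
    then show ?thesis by (simp add: lin mon)
  next
    case (Suc b)
    have pd: "pderiv (Polynomial.monom (1::'a) (Suc b)) = (of_nat b + 1) * Polynomial.monom 1 b"
      by (simp add: pderiv_monom of_nat_poly smult_monom algebra_simps flip: add_monom)
    show ?thesis
      unfolding Suc pd unfolding lin mon of_nat_Suc by (rule ring_identity_monom)
  qed
qed

context
  fixes x k a a' P :: "'a::comm_ring_1"
begin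

text \<open>Here \<open>a'\<close> is the derivative of \<open>a\<close>, \<open>k\<close> is m and
  \<open>P\<close> is (1 + x)^m. It works because x - x^3 = (1 + x)(x - x^2) and 1 + (2k + 1)x^2 +
  (k + 1)(x - x^2) = (1 + x)(1 + kx).\<close>

lemma ring_identity_binomial: "(1 + (2 * k + 1) * x ^ 2) * ((1 + x) * P * a)
    + (x - x ^ 3) * ((1 + x) * P * a' + a * ((k + 1) * P))
    = (1 + x) * ((1 + x) * P) * ((1 + k * x) * a + (x - x ^ 2) * a')"
  by (simp add: algebra_simps power2_eq_square power3_eq_cube)

text \<open>On functions of y = x^2 the chain rule turns x - x^3 into 2(y - y^2), which gives the
  type B recurrence.\<close>

lemma ring_identity_square: "(1 + (2 * k + 1) * x ^ 2) * a + (x - x ^ 3) * (a' * (2 * x))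
    = (1 + (2 * k + 1) * x ^ 2) * a + 2 * (x ^ 2 - (x ^ 2) ^ 2) * a'"
  by (simp add: algebra_simps eval_nat_numeral)

text \<open>Differentiating the extra factor x adds 1 - x^2 to the coefficient of \<open>a\<close>,
  making it 2(1 + k x^2). This 2 raises \<open>P\<close>, which is 2^m, to the next power.\<close>

lemma ring_identity_odd: "(1 + (2 * k + 1) * x ^ 2) * (P * x * a) + (x - x ^ 3) * (P * x * (a' * (2 * x)) + a * P)
   = 2 * P * x * ((1 + k * x ^ 2) * a + (x ^ 2 - (x ^ 2) ^ 2) * a')"
  by (simp add: algebra_simps eval_nat_numeral)

end

text \<open>
  All three terms satisfy the recurrence \<open>f\<^sub>m\<^sub>+\<^sub>1 = (1 + (2m + 1)x\<^sup>2) f\<^sub>m + (x - x\<^sup>3) f\<^sub>m'\<close>.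
\<close>

lemma eulerian_rec_dilation:
  "[:1, 1:] ^ Suc m * eulerian_rec m =
   pcompose (eulerian_rec_B m) [:0, 0, 1:]
   + [:0, 2 ^ m:] * pcompose (eulerian_rec m) [:0, 0, 1 :: 'a::field_char_0:]"
proof (induction m)
  case 0
  have "[:1, 1:] = 1 + [:0, 1 :: 'a:]" by (simp add: one_pCons)
  then show ?case
    by (simp only: power_Suc power_0 mult_1_right pcompose_1 eulerian_rec.simps(1)
      eulerian_rec_B.simps(1))
next
  case (Suc m)
  define x k where "x = [:0, 1 :: 'a:]" and "k = (of_nat m :: 'a poly)"
  define L where "L p = (1 + (2 * k + 1) * x ^ 2) * p + (x - x ^ 3) * pderiv p" for p :: "'a poly"
  let ?A = "eulerian_rec m :: 'a poly" and ?B = "eulerian_rec_B m :: 'a poly"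
  have lin: "[:1, 1:] = 1 + x" "[:0, 1, -1:] = x - x ^ 2" "[:0, 0, 1:] = x ^ 2"
    "[:1, of_nat m:] = 1 + k * x" "[:1, of_nat (2 * m + 1):] = 1 + (2 * k + 1) * x"
    by (simp_all add: x_def k_def one_pCons power2_eq_square of_nat_poly numeral_poly)
  have lin2: "[:0, 2 ^ j:] = 2 ^ j * x" for j
    by (simp add: x_def poly_const_pow numeral_poly)
  have dx: "pderiv x = 1" "pderiv (x ^ 2) = 2 * x"
    by (simp_all add: x_def pderiv_pCons one_pCons power2_eq_square numeral_poly)
  have kc: "pcompose k q = k" "pcompose x q = q" "pcompose 2 q = 2" "pcompose (x ^ 2) q = q ^ 2" for q
    by (simp_all add: power2_eq_square pcompose_mult k_def x_def of_nat_poly numeral_poly pcompose_pCons)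
  have L1: "L ([:1, 1:] ^ Suc m * ?A) = [:1, 1:] ^ Suc (Suc m) * eulerian_rec (Suc m)"
  proof -
    have "pderiv ((1 + x) ^ Suc m) = (k + 1) * (1 + x) ^ m"
      by (simp only: pderiv_power_Suc pderiv_add dx) (simp add: k_def of_nat_poly one_pCons add.commute)
    then show ?thesis 
      unfolding L_def lin eulerian_rec.simps pderiv_mult
      by (simp only: power_Suc) (rule ring_identity_binomial)
  qed
  have L2: "L (pcompose ?B (x ^ 2)) = pcompose (eulerian_rec_B (Suc m)) (x ^ 2)"
    unfolding L_def pderiv_pcompose eulerian_rec_B.simps lin pcompose_mult pcompose_add pcompose_diff pcompose_1 kc dx
    by (rule ring_identity_square)
  have L3: "L (2 ^ m * x * pcompose ?A (x ^ 2))
      = 2 ^ Suc m * x * pcompose (eulerian_rec (Suc m)) (x ^ 2)"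
  proof -
    have pd: "pderiv (2 ^ m * x) = 2 ^ m"
      by (simp add: poly_const_pow numeral_poly pderiv_smult dx)
    show ?thesis
      unfolding L_def pderiv_mult[of "2 ^ m * x"] pd pderiv_pcompose eulerian_rec.simps lin
        pcompose_mult pcompose_add pcompose_diff pcompose_1 kc dx power_Suc
      by (rule ring_identity_odd)
  qed
  have Ladd: "L (p + q) = L p + L q" for p q
    by (simp add: L_def pderiv_add algebra_simps)
  have "[:1, 1:] ^ Suc (Suc m) * eulerian_rec (Suc m) = L ([:1, 1:] ^ Suc m * ?A)"
    by (rule L1[symmetric])
  also have "\<dots> = L (pcompose ?B (x ^ 2) + 2 ^ m * x * pcompose ?A (x ^ 2))"
    using Suc.IH by (simp only: lin(3) lin2)
  also have "\<dots> = pcompose (eulerian_rec_B (Suc m)) (x ^ 2)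
      + 2 ^ Suc m * x * pcompose (eulerian_rec (Suc m)) (x ^ 2)"
    by (simp only: Ladd L2 L3)
  finally show ?case by (simp only: lin(3) lin2)
qed

section \<open>Generating functions of ascents over plain and signed words\<close>

lemma sum_keyed_lists_id_insert:
  fixes f :: "'b list \<Rightarrow> 'a::comm_monoid_add"
  assumes "finite A" "M \<notin> A"
  shows "(\<Sum>xs\<in>keyed_lists id (insert M A). f xs)
    = (\<Sum>ys\<in>keyed_lists id A. \<Sum>k\<le>length ys. f (take k ys @ M # drop k ys))"
  using sum_keyed_lists_insert[of "insert M A" M id f] assms by (simp add: vimage_def)

lemma abs_vimage_singleton:
  fixes M :: "'b::linordered_idom"
  shows "0 < M \<Longrightarrow> abs -` {M} = {M, - M}"
  by (auto simp: abs_if split: if_splits)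

lemma sum_keyed_lists_abs_insert:
  fixes f :: "'b::linordered_idom list \<Rightarrow> 'a::comm_monoid_add"
  assumes "finite A" "\<forall>a\<in>A. 0 < a" "0 < M" "M \<notin> A"
  shows "(\<Sum>xs\<in>keyed_lists abs (insert M A). f xs)
    = (\<Sum>ys\<in>keyed_lists abs A. (\<Sum>k\<le>length ys. f (take k ys @ M # drop k ys))
        + (\<Sum>k\<le>length ys. f (take k ys @ - M # drop k ys)))"
proof -
  have "finite (abs -` {a})" if "a \<in> insert M A" for a
    using that assms by (auto simp: abs_vimage_singleton)
  moreover have "M \<noteq> - M" using assms by linarith
  ultimately show ?thesis
    using sum_keyed_lists_insert[of "insert M A" M abs f] assms by (simp add: abs_vimage_singleton)
qed

lemma keyed_lists_abs_bounds:
  fixes M :: "'b::linordered_idom"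
  assumes "ys \<in> keyed_lists abs A" "\<forall>a\<in>A. a < M"
  shows "\<forall>y\<in>set ys. y < M" "\<forall>y\<in>set ys. - M < y"
proof -
  have "\<forall>y\<in>set ys. \<bar>y\<bar> < M" using assms by (auto simp: keyed_lists_def)
  then show "\<forall>y\<in>set ys. y < M" "\<forall>y\<in>set ys. - M < y" by auto
qed

lemma pderiv_sum: "pderiv (sum f A) = (\<Sum>x\<in>A. pderiv (f x))"
  by (induction A rule: infinite_finite_induct) (simp_all add: pderiv_add)

lemma sum_mult_pderiv:
  "(\<Sum>x\<in>A. p * f x + q * pderiv (f x)) = p * sum f A + q * pderiv (sum f A)"
  by (simp add: sum.distrib pderiv_sum sum_distrib_left)

lemma sum_monom_ascents_perms:
  assumes "finite (S :: 'b::linorder set)"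
  shows "(\<Sum>xs\<in>keyed_lists id S. Polynomial.monom 1 (ascents xs))
    = (eulerian_rec (card S) :: 'a::field_char_0 poly)"
  using assms
proof (induction S rule: finite_linorder_max_induct)
  case (insert M A)
  let ?X = "Polynomial.monom (1::'a)"
  have "M \<notin> A" using insert by auto
  have step: "(\<Sum>k\<le>length ys. ?X (ascents (take k ys @ M # drop k ys)))
      = [:1, of_nat (card A):] * ?X (ascents ys) + [:0, 1, -1:] * pderiv (?X (ascents ys))"
    if "ys \<in> keyed_lists id A" for ys
  proof -
    have "\<forall>y\<in>set ys. y < M" using that insert by (auto simp: keyed_lists_def)
    then show ?thesis
      using keyed_lists_length[OF that] unfolding pderiv_monom_ascents[symmetric]
      by (subst sum_ascents_insert) auto
  qed
  have "(\<Sum>xs\<in>keyed_lists id (insert M A). ?X (ascents xs))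
    = [:1, of_nat (card A):] * (\<Sum>xs\<in>keyed_lists id A. ?X (ascents xs))
      + [:0, 1, -1:] * pderiv (\<Sum>xs\<in>keyed_lists id A. ?X (ascents xs))"
    unfolding sum_keyed_lists_id_insert[OF insert(1) \<open>M \<notin> A\<close>] sum_mult_pderiv[symmetric]
    by (rule sum.cong[OF refl step])
  then show ?case
    unfolding insert.IH card_insert_disjoint[OF insert(1) \<open>M \<notin> A\<close>]
    by (simp only: eulerian_rec.simps)
qed (simp add: keyed_lists_empty)

text \<open>\<open>M\<close> and \<open>- M\<close> lie on opposite sides of all earlier letters,
  and \<open>sum_ascents_insert\<close> gives the same count for both, whence a factor 2 per letter.
  The letters are an arbitrary positive set because a letter of any absolute value is removed
  later.\<close>

lemma sum_monom_ascents:
  assumes "finite (S :: 'b::linordered_idom set)" "\<forall>s\<in>S. 0 < s"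
  shows "(\<Sum>xs\<in>keyed_lists abs S. Polynomial.monom 1 (ascents xs))
    = Polynomial.smult (2 ^ card S) (eulerian_rec (card S) :: 'a::field_char_0 poly)"
  using assms
proof (induction S rule: finite_linorder_max_induct)
  case (insert M A)
  let ?X = "Polynomial.monom (1::'a)"
  have M: "M \<notin> A" "0 < M" "\<forall>a\<in>A. 0 < a" using insert by auto
  have step: "(\<Sum>k\<le>length ys. ?X (ascents (take k ys @ M # drop k ys)))
      + (\<Sum>k\<le>length ys. ?X (ascents (take k ys @ - M # drop k ys)))
      = 2 * [:1, of_nat (card A):] * ?X (ascents ys) + 2 * [:0, 1, -1:] * pderiv (?X (ascents ys))"
    if "ys \<in> keyed_lists abs A" for ys
    using keyed_lists_abs_bounds[OF that insert(2)] keyed_lists_length[OF that]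
    unfolding mult.assoc distrib_left[symmetric] pderiv_monom_ascents[symmetric]
    by (subst (1 2) sum_ascents_insert) simp_all
  have "(\<Sum>xs\<in>keyed_lists abs (insert M A). ?X (ascents xs))
    = 2 * [:1, of_nat (card A):] * (\<Sum>xs\<in>keyed_lists abs A. ?X (ascents xs))
      + 2 * [:0, 1, -1:] * pderiv (\<Sum>xs\<in>keyed_lists abs A. ?X (ascents xs))"
    unfolding sum_keyed_lists_abs_insert[OF insert(1) M(3,2,1)] sum_mult_pderiv[symmetric]
    by (rule sum.cong[OF refl step])
  also have "\<dots> = Polynomial.smult (2 ^ Suc (card A)) (eulerian_rec (Suc (card A)))"
    using M(3) by (simp add: insert.IH pderiv_smult smult_add_right numeral_poly mult_ac)
  finally show ?case using insert(1) M by simp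
qed (simp add: keyed_lists_empty)

text \<open>The slot behind \<open>z\<close> is excluded. There \<open>M\<close> would give
  \<open>Suc a\<close> and \<open>- M\<close> would give \<open>a\<close>, so each of the two
  doubled counts of \<open>sum_ascents_insert\<close> loses one.\<close>

lemma sum_ascents_insert_snoc:
  fixes f :: "nat \<Rightarrow> 'a::comm_ring_1"
  assumes "\<forall>x\<in>set (ys @ [z]). x < M" "\<forall>x\<in>set (ys @ [z]). - M < (x::'b::linordered_idom)"
  defines "a \<equiv> ascents (ys @ [z])" and "m \<equiv> length ys"
  shows "(\<Sum>k\<le>m. f (ascents ((take k ys @ M # drop k ys) @ [z])))
      + (\<Sum>k\<le>m. f (ascents ((take k ys @ - M # drop k ys) @ [z])))
    = (2 * of_nat a + 1) * f a + (2 * (of_nat m - of_nat a) + 1) * f (Suc a)"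
proof -
  have full: "(\<Sum>k\<le>m. f (ascents ((take k ys @ v # drop k ys) @ [z]))) + f (ascents (ys @ [z, v]))
    = (\<Sum>k\<le>length (ys @ [z]). f (ascents (take k (ys @ [z]) @ v # drop k (ys @ [z]))))" for v
    by (simp add: m_def)
  have ends: "ascents (ys @ [z, M]) = Suc a" "ascents (ys @ [z, - M]) = a"
    using assms ascents_snoc[of "ys @ [z]"] by auto
  have ins: "(\<Sum>k\<le>m. f (ascents ((take k ys @ v # drop k ys) @ [z])))
     = (of_nat a + 1) * f a + (of_nat m + 1 - of_nat a) * f (Suc a) - f (ascents (ys @ [z, v]))"
    if "v \<in> {M, - M}" for v
    using that assms(1,2) unfolding eq_diff_eq full
    by (subst sum_ascents_insert) (auto simp: a_def m_def add.commute)
  show ?thesis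
    by (simp only: ins insertI1 insertI2 ends) (simp add: algebra_simps)
qed

text \<open>Excluding the outer slots removes one \<open>f a\<close> and one
  \<open>f (Suc a)\<close>, for \<open>M\<close> as well as for \<open>- M\<close>.\<close>

lemma sum_ascents_insert_both:
  fixes f :: "nat \<Rightarrow> 'a::comm_ring_1"
  assumes "\<forall>x\<in>set (y # ys @ [z]). x < M" "\<forall>x\<in>set (y # ys @ [z]). - M < (x::'b::linordered_idom)"
  defines "a \<equiv> ascents (y # ys @ [z])" and "m \<equiv> length ys"
  shows "(\<Sum>k\<le>m. f (ascents (y # (take k ys @ M # drop k ys) @ [z])))
      + (\<Sum>k\<le>m. f (ascents (y # (take k ys @ - M # drop k ys) @ [z])))
    = 2 * of_nat a * f a + 2 * (of_nat m + 1 - of_nat a) * f (Suc a)"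
proof -
  let ?zs = "y # ys @ [z]"
  have peel: "(\<Sum>k\<le>length ?zs. g k) = (\<Sum>k\<le>m. g (Suc k)) + g 0 + g (Suc (Suc m))" for g :: "nat \<Rightarrow> 'a"
    using sum.atMost_Suc_shift[of g "Suc m"] by (simp add: m_def algebra_simps)
  have full: "(\<Sum>k\<le>m. f (ascents (y # (take k ys @ v # drop k ys) @ [z])))
      + f (ascents (v # ?zs)) + f (ascents (?zs @ [v]))
    = (\<Sum>k\<le>length ?zs. f (ascents (take k ?zs @ v # drop k ?zs)))" for v
    unfolding peel by (simp add: m_def)
  have ends: "ascents (M # ?zs) = a" "ascents (- M # ?zs) = Suc a"
    "ascents (?zs @ [M]) = Suc a" "ascents (?zs @ [- M]) = a"
    using assms ascents_snoc[of ?zs] by (auto simp: less_imp_not_less)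
  have ins: "(\<Sum>k\<le>m. f (ascents (y # (take k ys @ v # drop k ys) @ [z])))
     = (of_nat a + 1) * f a + (of_nat m + 2 - of_nat a) * f (Suc a)
       - f (ascents (?zs @ [v])) - f (ascents (v # ?zs))"
    if "v \<in> {M, - M}" for v
    using that assms(1,2) unfolding eq_diff_eq full
    by (subst sum_ascents_insert) (auto simp: a_def m_def add.commute)
  show ?thesis
    by (simp only: ins insertI1 insertI2 ends) (simp add: algebra_simps)
qed

text \<open>The zero counts a negative last letter as an ascent, which models the type B descent at
  i = n. Hence \<open>eulerian_rec_B\<close> is the Eulerian polynomial of type B.\<close>

lemma sum_monom_ascents_snoc_0:
  assumes "finite (S :: 'b::linordered_idom set)" "\<forall>s\<in>S. 0 < s"
  shows "(\<Sum>xs\<in>keyed_lists abs S. Polynomial.monom 1 (ascents (xs @ [0])))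
    = (eulerian_rec_B (card S) :: 'a::field_char_0 poly)"
  using assms
proof (induction S rule: finite_linorder_max_induct)
  case (insert M A)
  let ?X = "Polynomial.monom (1::'a)"
  have M: "M \<notin> A" "0 < M" "\<forall>a\<in>A. 0 < a" using insert by auto
  have step: "(\<Sum>k\<le>length ys. ?X (ascents ((take k ys @ M # drop k ys) @ [0])))
      + (\<Sum>k\<le>length ys. ?X (ascents ((take k ys @ - M # drop k ys) @ [0])))
      = [:1, of_nat (2 * card A + 1):] * ?X (ascents (ys @ [0]))
        + 2 * [:0, 1, -1:] * pderiv (?X (ascents (ys @ [0])))"
    if "ys \<in> keyed_lists abs A" for ys
  proof -
    let ?a = "ascents (ys @ [0])" and ?m = "card A"
    \<comment> \<open>The coefficients 2a + 1 and 2(m - a) + 1 differ by -1 and +1 from twice those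
      of a free insertion; the summand x - 1 carries this correction.\<close>
    have "[:1, of_nat (2 * ?m + 1):] = 2 * [:1 :: 'a, of_nat ?m:] + [:-1, 1:]"
      by (simp add: numeral_poly)
    then have "[:1, of_nat (2 * ?m + 1):] * ?X ?a + 2 * [:0, 1, -1:] * pderiv (?X ?a)
      = 2 * ([:1, of_nat ?m:] * ?X ?a + [:0, 1, -1:] * pderiv (?X ?a)) + [:-1, 1:] * ?X ?a"
      by (simp only: distrib_left distrib_right mult.assoc add_ac)
    also have "[:-1, 1:] * ?X ?a = ?X (Suc ?a) - ?X ?a"
      by (simp add: monom_Suc)
    finally show ?thesis
      unfolding pderiv_monom_ascents[symmetric]
      using keyed_lists_abs_bounds[OF that insert(2)] keyed_lists_length[OF that] M
      by (subst sum_ascents_insert_snoc) (auto simp: algebra_simps)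
  qed
  have "(\<Sum>xs\<in>keyed_lists abs (insert M A). ?X (ascents (xs @ [0])))
    = [:1, of_nat (2 * card A + 1):] * (\<Sum>xs\<in>keyed_lists abs A. ?X (ascents (xs @ [0])))
      + 2 * [:0, 1, -1:] * pderiv (\<Sum>xs\<in>keyed_lists abs A. ?X (ascents (xs @ [0])))"
    unfolding sum_keyed_lists_abs_insert[OF insert(1) M(3,2,1)] sum_mult_pderiv[symmetric]
    by (rule sum.cong[OF refl step])
  then show ?case
    unfolding insert.IH[OF M(3)] card_insert_disjoint[OF insert(1) M(1)] by simp
qed (simp add: keyed_lists_empty)

text \<open>Between two zeros the ascents are those of a cyclic word. Read from its largest letter,
  it has one ascent more than the word of the other letters, which explains x times the type A
  polynomial for each choice of signs. The proof itself goes by insertion.\<close>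

lemma sum_monom_ascents_0_snoc_0:
  assumes "finite (S :: 'b::linordered_idom set)" "S \<noteq> {}" "\<forall>s\<in>S. 0 < s"
  shows "(\<Sum>xs\<in>keyed_lists abs S. Polynomial.monom 1 (ascents (0 # xs @ [0])))
    = Polynomial.smult (2 ^ card S) ([:0, 1:] * (eulerian_rec (card S) :: 'a::field_char_0 poly))"
  using assms
proof (induction S rule: finite_linorder_max_induct)
  case (insert M A)
  let ?X = "Polynomial.monom (1::'a)"
  have M: "M \<notin> A" "0 < M" "\<forall>a\<in>A. 0 < a" using insert by auto
  show ?case
  \<comment> \<open>Without letters, \<open>[0, 0]\<close> has no ascent whereas the formula would
    give x; so the induction starts with one letter.\<close>
  proof (cases "A = {}")
    case True
    then show ?thesis
      using M sum_keyed_lists_abs_insert[of "{}" M "\<lambda>xs. ?X (ascents (0 # xs @ [0]))"]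
      by (simp add: keyed_lists_empty monom_Suc numeral_poly)
  next
    case False
    define x :: "'a poly" where "x = [:0, 1:]"
    have step: "(\<Sum>k\<le>length ys. ?X (ascents (0 # (take k ys @ M # drop k ys) @ [0])))
        + (\<Sum>k\<le>length ys. ?X (ascents (0 # (take k ys @ - M # drop k ys) @ [0])))
        = 2 * ((of_nat (card A) + 1) * x) * ?X (ascents (0 # ys @ [0]))
          + 2 * (x - x ^ 2) * pderiv (?X (ascents (0 # ys @ [0])))"
      if "ys \<in> keyed_lists abs A" for ys
    proof -
      let ?a = "ascents (0 # ys @ [0])" and ?m = "card A"
      have lin: "[:1, of_nat ?m:] = 1 + of_nat ?m * x" "[:0, 1, -1:] = x - x ^ 2"
        by (simp_all add: x_def one_pCons of_nat_poly power2_eq_square)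
      \<comment> \<open>Excluding both ends changes the free coefficients a + 1 and m - a to a and m
        + 1 - a, that is, it adds x - 1 to the multiplier 1 + mx.\<close>
      have "(of_nat ?m + 1) * x * ?X ?a + (x - x ^ 2) * pderiv (?X ?a)
        = ([:1, of_nat ?m:] * ?X ?a + [:0, 1, -1:] * pderiv (?X ?a)) + x * ?X ?a - ?X ?a"
        by (simp only: lin) (simp add: algebra_simps)
      also have "x * ?X ?a = ?X (Suc ?a)"
        by (simp add: x_def monom_Suc)
      finally have eq: "(of_nat ?m + 1) * x * ?X ?a + (x - x ^ 2) * pderiv (?X ?a)
        = ([:1, of_nat ?m:] * ?X ?a + [:0, 1, -1:] * pderiv (?X ?a)) + ?X (Suc ?a) - ?X ?a" .
      have "2 * ((of_nat ?m + 1) * x) * ?X ?a + 2 * (x - x ^ 2) * pderiv (?X ?a)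
        = 2 * ((of_nat ?m + 1) * x * ?X ?a + (x - x ^ 2) * pderiv (?X ?a))"
        by (simp only: mult.assoc distrib_left)
      then show ?thesis
        unfolding eq pderiv_monom_ascents[symmetric]
        using keyed_lists_abs_bounds[OF that insert(2)] keyed_lists_length[OF that] M
        by (subst sum_ascents_insert_both) (auto simp: algebra_simps)
    qed
    have "(\<Sum>xs\<in>keyed_lists abs (insert M A). ?X (ascents (0 # xs @ [0])))
      = 2 * ((of_nat (card A) + 1) * x) * (\<Sum>xs\<in>keyed_lists abs A. ?X (ascents (0 # xs @ [0])))
          + 2 * (x - x ^ 2) * pderiv (\<Sum>xs\<in>keyed_lists abs A. ?X (ascents (0 # xs @ [0])))"
      unfolding sum_keyed_lists_abs_insert[OF insert(1) M(3,2,1)] sum_mult_pderiv[symmetric]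
      by (rule sum.cong[OF refl step])
    also have "(\<Sum>xs\<in>keyed_lists abs A. ?X (ascents (0 # xs @ [0])))
        = Polynomial.smult (2 ^ card A) (x * eulerian_rec (card A))"
      unfolding x_def using insert False by simp
    also have "2 * ((of_nat (card A) + 1) * x) * \<dots> + 2 * (x - x ^ 2) * pderiv \<dots>
      = Polynomial.smult (2 ^ Suc (card A)) (x * eulerian_rec (Suc (card A)))"
    proof -
      have lin: "[:1, of_nat (card A):] = 1 + of_nat (card A) * x" "[:0, 1, -1:] = x - x ^ 2"
        by (simp_all add: x_def one_pCons of_nat_poly power2_eq_square)
      have dx: "pderiv x = 1" by (simp add: x_def pderiv_pCons one_pCons)
      have sm: "Polynomial.smult (2 ^ j) p = 2 ^ j * p" for j and p :: "'a poly"
        by (simp add: poly_const_pow numeral_poly)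
      show ?thesis
        unfolding eulerian_rec.simps lin pderiv_smult pderiv_mult dx unfolding sm
        by (simp add: algebra_simps power2_eq_square)
    qed
    finally show ?thesis using insert M by (simp add: x_def)
  qed
qed simp

lemma sum_keyed_lists_abs_rev_uminus:
  fixes f :: "'b::linordered_idom list \<Rightarrow> 'a::comm_monoid_add"
  shows "(\<Sum>xs\<in>keyed_lists abs S. f (map uminus (rev xs))) = (\<Sum>xs\<in>keyed_lists abs S. f xs)"
  by (rule sum.reindex_bij_witness[where i = "\<lambda>xs. map uminus (rev xs)" and j = "\<lambda>xs. map uminus (rev xs)"])
    (auto simp: keyed_lists_def rev_map o_def image_image distinct_map inj_on_def)

text \<open>Reversing and negating moves a leading zero to the end.\<close>

lemma sum_ascents_0_Cons:
  fixes f :: "nat \<Rightarrow> 'a::comm_monoid_add"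
  shows "(\<Sum>xs\<in>keyed_lists abs S. f (ascents (0 # xs)))
    = (\<Sum>xs\<in>keyed_lists abs S. f (ascents (xs @ [0 :: 'b::linordered_idom])))"
proof -
  have "ascents (0 # xs) = ascents (map uminus (rev xs) @ [0])" for xs :: "'b list"
    using ascents_map_uminus_rev[of "0 # xs"] by simp
  then show ?thesis
    by (simp only: sum_keyed_lists_abs_rev_uminus[of "\<lambda>xs. f (ascents (xs @ [0]))"])
qed

section \<open>Evaluation at points and sums weighted by the sign of the last letter\<close>

context
  fixes S :: "'b::linordered_idom set"
  assumes S: "finite S" "\<forall>s\<in>S. 0 < s"
begin

lemma sum_power_ascents:
  "(\<Sum>xs\<in>keyed_lists abs S. y ^ ascents xs) = 2 ^ card S * poly (eulerian_rec (card S)) (y :: 'a::field_char_0)"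
  using arg_cong[OF sum_monom_ascents[OF S], of "\<lambda>p. poly p y"]
  by (simp add: poly_sum poly_monom)

lemma sum_power_ascents_snoc_0:
  "(\<Sum>xs\<in>keyed_lists abs S. y ^ ascents (xs @ [0])) = poly (eulerian_rec_B (card S)) (y :: 'a::field_char_0)"
  using arg_cong[OF sum_monom_ascents_snoc_0[OF S], of "\<lambda>p. poly p y"]
  by (simp add: poly_sum poly_monom)

lemma sum_power_ascents_0_snoc_0:
  "S \<noteq> {} \<Longrightarrow> (\<Sum>xs\<in>keyed_lists abs S. y ^ ascents (0 # xs @ [0]))
    = 2 ^ card S * y * poly (eulerian_rec (card S)) (y :: 'a::field_char_0)"
  using arg_cong[OF sum_monom_ascents_0_snoc_0[OF S(1) _ S(2)], of "\<lambda>p. poly p y"]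
  by (simp add: poly_sum poly_monom mult.assoc)

end

lemma poly_eulerian_rec_dilation:
  "(x + 1) ^ Suc m * poly (eulerian_rec m) x =
   poly (eulerian_rec_B m) (x\<^sup>2) + 2 ^ m * x * poly (eulerian_rec m) (x\<^sup>2 :: 'a::field_char_0)"
  using arg_cong[OF eulerian_rec_dilation[of m], of "\<lambda>p. poly p x"]
  by (simp add: poly_pcompose power2_eq_square algebra_simps)

lemma finite_keyed_lists_abs:
  fixes S :: "'b::linordered_idom set"
  assumes "finite S" "\<forall>s\<in>S. 0 < s"
  shows "finite (keyed_lists abs S)"
  using assms by (intro finite_keyed_lists) (auto simp: abs_vimage_singleton)

lemma keyed_lists_abs_neq_0:
  fixes S :: "'b::linordered_idom set"
  assumes "\<forall>s\<in>S. 0 < s" "xs \<in> keyed_lists abs S" "x \<in> set xs"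
  shows "x \<noteq> 0"
  using assms by (auto simp: keyed_lists_def)

text \<open>The factor \<open>(x\<^sup>2) ^ of_bool (last xs < 0)\<close> amounts to appending a
  zero. With A and B the two recurrence polynomials at x^2 and n the number of letters, the sums are
  x 2^n A + B and x B + 2^n x^2 A, and the second is x times the first.\<close>

lemma sum_power_ascents_weighted:
  fixes S :: "'b::linordered_idom set" and x :: "'a::field_char_0"
  assumes S: "finite S" "\<forall>s\<in>S. 0 < s" "S \<noteq> {}"
  shows "(\<Sum>xs\<in>keyed_lists abs S. (x\<^sup>2) ^ ascents xs * (x + (x\<^sup>2) ^ of_bool (last xs < 0)))
    = (x + 1) ^ Suc (card S) * poly (eulerian_rec (card S)) x" (is "?L = _")
    and "(\<Sum>xs\<in>keyed_lists abs S. (x\<^sup>2) ^ ascents (0 # xs) * (x + (x\<^sup>2) ^ of_bool (last xs < 0)))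
    = x * ((x + 1) ^ Suc (card S) * poly (eulerian_rec (card S)) x)" (is "?K = _")
proof -
  have ne: "xs \<noteq> []" if "xs \<in> keyed_lists abs S" for xs
    using that S(3) by (auto simp: keyed_lists_def)
  have "?L = (\<Sum>xs\<in>keyed_lists abs S. x * (x\<^sup>2) ^ ascents xs + (x\<^sup>2) ^ ascents (xs @ [0]))"
    by (intro sum.cong refl) (simp add: ascents_snoc ne power_add algebra_simps)
  then show "?L = (x + 1) ^ Suc (card S) * poly (eulerian_rec (card S)) x"
    unfolding poly_eulerian_rec_dilation
    using S(1,2) by (simp add: sum.distrib sum_power_ascents sum_power_ascents_snoc_0 flip: sum_distrib_left)
  have "?K = (\<Sum>xs\<in>keyed_lists abs S. x * (x\<^sup>2) ^ ascents (0 # xs) + (x\<^sup>2) ^ ascents (0 # xs @ [0]))"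
  proof (intro sum.cong refl)
    fix xs :: "'b list" assume "xs \<in> keyed_lists abs S"
    then show "(x\<^sup>2) ^ ascents (0 # xs) * (x + (x\<^sup>2) ^ of_bool (last xs < 0))
      = x * (x\<^sup>2) ^ ascents (0 # xs) + (x\<^sup>2) ^ ascents (0 # xs @ [0])"
      using ne[of xs] ascents_snoc[of "0 # xs" 0] by (simp add: power_add algebra_simps)
  qed
  then show "?K = x * ((x + 1) ^ Suc (card S) * poly (eulerian_rec (card S)) x)"
    unfolding poly_eulerian_rec_dilation
    using S sum_ascents_0_Cons[of "\<lambda>k. (x\<^sup>2) ^ k" S]
    by (simp add: sum.distrib sum_power_ascents_0_snoc_0 sum_power_ascents_snoc_0
        flip: sum_distrib_left) (simp add: algebra_simps power2_eq_square)
qed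

section \<open>Trading the condition on the first two letters for one on the first\<close>

lemma sum_keyed_lists_abs_flip_hd:
  fixes f :: "'b::linordered_idom list \<Rightarrow> 'a::comm_monoid_add"
  assumes "S \<noteq> {}"
  shows "(\<Sum>xs\<in>keyed_lists abs S. f (- hd xs # tl xs)) = (\<Sum>xs\<in>keyed_lists abs S. f xs)"
proof -
  have "xs \<noteq> []" if "xs \<in> keyed_lists abs S" for xs :: "'b list"
    using that assms by (auto simp: keyed_lists_def)
  then have "\<exists>u us. xs = u # us" if "xs \<in> keyed_lists abs S" for xs :: "'b list"
    using that by (metis list.exhaust)
  then show ?thesis
    by (intro sum.reindex_bij_witness[where i = "\<lambda>xs. - hd xs # tl xs" and j = "\<lambda>xs. - hd xs # tl xs"])
      (force simp: keyed_lists_def)+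
qed

text \<open>If |u| > |v|, all four exponents are 1. If |u| < |v|, the sign of u shows only in
  [0 < u], and with c = [0 < v] the sum is 2(y^c + y^(c+1)) - 2y^(2c), which is 2y for both values
  of c.\<close>

lemma flip_sign_weight:
  fixes u v :: "'b::linordered_idom" and y :: "'a::comm_ring_1"
  assumes "u \<noteq> 0" "v \<noteq> 0" "\<bar>u\<bar> \<noteq> \<bar>v\<bar>"
  shows "(2 * y ^ (of_bool (0 < u) + of_bool (u < v)) - y ^ (of_bool (u < v) + of_bool (0 < u + v)))
    + (2 * y ^ (of_bool (0 < - u) + of_bool (- u < v)) - y ^ (of_bool (- u < v) + of_bool (0 < - u + v)))
    = 2 * y"
proof -
  consider "\<bar>u\<bar> < v" | "v < - \<bar>u\<bar>" | "\<bar>v\<bar> < u" | "u < - \<bar>v\<bar>"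
    using assms by linarith
  then show ?thesis
  proof cases
    case 1
    then have "u < v" "0 < u + v" "- u < v" "0 < - u + v" by linarith+
    with assms(1) show ?thesis by (cases "0 < u") (auto simp: power2_eq_square)
  next
    case 2
    then have "\<not> u < v" "\<not> 0 < u + v" "\<not> - u < v" "\<not> 0 < - u + v" by linarith+
    with assms(1) show ?thesis by (cases "0 < u") (auto simp: power2_eq_square)
  next
    case 3
    then have "\<not> u < v" "0 < u + v" "- u < v" "\<not> 0 < - u + v" "0 < u" by linarith+
    then show ?thesis by simp
  next
    case 4
    then have "u < v" "\<not> 0 < u + v" "\<not> - u < v" "0 < - u + v" "u < 0" by linarith+
    then show ?thesis by simp
  qed
qed

theorem sum_type_D_weighted:
  fixes S :: "'b::linordered_idom set" and x :: "'a::field_char_0"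
  assumes S: "finite S" "\<forall>s\<in>S. 0 < s" "card S \<ge> 2"
  defines "G \<equiv> \<lambda>m. (x + 1) ^ Suc m * poly (eulerian_rec m) x"
  shows "(\<Sum>xs\<in>keyed_lists abs S. (x\<^sup>2) ^ (ascents xs + of_bool (0 < xs ! 0 + xs ! 1))
      * (x + (x\<^sup>2) ^ of_bool (last xs < 0)))
    = 2 * (x * G (card S)) - 2 * of_nat (card S) * x\<^sup>2 * G (card S - 1)"
proof -
  define y where "y = x\<^sup>2"
  define F :: "'b list \<Rightarrow> 'a" where "F xs = x + y ^ of_bool (last xs < 0)" for xs
  \<comment> \<open>The coefficient 2 fits \<open>flip_sign_weight\<close>. The factor
    \<open>F\<close> depends only on the last letter, which is not the first, so it is common to a
    word and its flipped partner.\<close>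
  define h where "h xs = (2 * y ^ ascents (0 # xs) - y ^ (ascents xs + of_bool (0 < xs ! 0 + xs ! 1))) * F xs" for xs
  have "S \<noteq> {}" using S by auto
  have flip: "h xs + h (- hd xs # tl xs) = 2 * y * (y ^ ascents (tl xs) * F (tl xs))"
    if xs: "xs \<in> keyed_lists abs S" for xs
  proof -
    have "length xs \<ge> 2" using keyed_lists_length[OF xs] S by simp
    then obtain u v r where uvr: "xs = u # v # r"
      by (metis One_nat_def Suc_1 Suc_le_length_iff)
    have "u \<noteq> 0" "v \<noteq> 0" using keyed_lists_abs_neq_0[OF S(2) xs] by (auto simp: uvr)
    moreover have "\<bar>u\<bar> \<noteq> \<bar>v\<bar>" using xs by (auto simp: keyed_lists_def uvr)
    ultimately have w: "(2 * y ^ (of_bool (0 < u) + of_bool (u < v)) - y ^ (of_bool (u < v) + of_bool (0 < u + v)))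
    + (2 * y ^ (of_bool (0 < - u) + of_bool (- u < v)) - y ^ (of_bool (- u < v) + of_bool (0 < - u + v)))
    = 2 * y" by (rule flip_sign_weight)
    have "h (w # v # r) = (2 * y ^ (of_bool (0 < w) + of_bool (w < v)) - y ^ (of_bool (w < v) + of_bool (0 < w + v)))
      * (y ^ ascents (v # r) * F (v # r))" for w
      by (simp add: h_def F_def power_add algebra_simps)
    then show ?thesis
      unfolding uvr w[symmetric] by (simp only: list.sel distrib_right)
  qed
  \<comment> \<open>The first letter is free, with \<open>card S\<close> absolute values and two
    signs; each choice leaves a weighted sum over one letter less. At least one letter remains, as
    \<open>last\<close> in \<open>F\<close> requires.\<close>
  have tail: "(\<Sum>xs\<in>keyed_lists abs S. y ^ ascents (tl xs) * F (tl xs)) = 2 * of_nat (card S) * G (card S - 1)"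
  proof -
    have fin: "finite (abs -` {M})" if "M \<in> S" for M using that S by (auto simp: abs_vimage_singleton)
    have "(\<Sum>v\<in>abs -` {M}. \<Sum>ys\<in>keyed_lists abs (S - {M}). y ^ ascents ys * F ys) = 2 * G (card S - 1)"
      if "M \<in> S" for M
    proof -
      have "S - {M} \<noteq> {}"
      proof
        assume "S - {M} = {}"
        then have "S \<subseteq> {M}" by auto
        then show False using S(3) card_mono[of "{M}" S] by simp
      qed
      then have "(\<Sum>ys\<in>keyed_lists abs (S - {M}). y ^ ascents ys * F ys) = G (card (S - {M}))"
        unfolding y_def F_def G_def using S by (intro sum_power_ascents_weighted) auto
      moreover have "0 < M" using that S by auto
      then have "card (abs -` {M}) = 2"
        by (auto simp: abs_vimage_singleton card_insert_if)
      ultimately show ?thesis using that S by simp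
    qed
    then show ?thesis
      using sum_keyed_lists_Cons[OF S(1) \<open>S \<noteq> {}\<close> fin, where f = "\<lambda>xs. y ^ ascents (tl xs) * F (tl xs)"]
      by simp
  qed
  have "2 * sum h (keyed_lists abs S) = (\<Sum>xs\<in>keyed_lists abs S. h xs + h (- hd xs # tl xs))"
    unfolding sum.distrib sum_keyed_lists_abs_flip_hd[OF \<open>S \<noteq> {}\<close>] by simp
  also have "\<dots> = 2 * (y * (2 * of_nat (card S) * G (card S - 1)))"
    unfolding tail[symmetric] by (simp add: flip sum_distrib_left mult.assoc)
  finally have h: "sum h (keyed_lists abs S) = y * (2 * of_nat (card S) * G (card S - 1))"
    by simp
  have "(\<Sum>xs\<in>keyed_lists abs S. y ^ ascents (0 # xs) * F xs) = x * G (card S)"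
    unfolding y_def F_def G_def using S(1,2) \<open>S \<noteq> {}\<close> by (rule sum_power_ascents_weighted)
  then have "2 * (x * G (card S)) = (\<Sum>xs\<in>keyed_lists abs S. 2 * (y ^ ascents (0 # xs) * F xs))"
    by (simp only: sum_distrib_left[symmetric])
  moreover have "(\<Sum>xs\<in>keyed_lists abs S. y ^ (ascents xs + of_bool (0 < xs ! 0 + xs ! 1)) * F xs)
     = (\<Sum>xs\<in>keyed_lists abs S. 2 * (y ^ ascents (0 # xs) * F xs)) - sum h (keyed_lists abs S)"
    unfolding sum_subtractf[symmetric] by (intro sum.cong refl) (simp add: h_def algebra_simps)
  ultimately show ?thesis
    unfolding h by (simp add: y_def F_def mult_ac)
qed

section \<open>Lengths from a model of the inversions\<close>

text \<open>
  Words are in bijection with the group, \<open>\<Phi>\<close> stands for the positive roots, \<open>neg w r\<close> for the root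
  \<open>r\<close> being sent to a negative one, and \<open>t i\<close> for the action of \<open>s i\<close> on the positive roots other than the
  simple one.
\<close>

locale root_words = group G for G (structure) +
  fixes s :: "nat \<Rightarrow> 'a" and n :: nat
    and W :: "'w set" and w0 :: 'w and m :: "'w \<Rightarrow> 'a" and act :: "nat \<Rightarrow> 'w \<Rightarrow> 'w"
    and \<Phi> :: "'r set" and root :: "nat \<Rightarrow> 'r" and t :: "nat \<Rightarrow> 'r \<Rightarrow> 'r" and neg :: "'w \<Rightarrow> 'r \<Rightarrow> bool"
  assumes gen_closed: "i \<in> {1..n} \<Longrightarrow> s i \<in> carrier G"
    and gen_square: "i \<in> {1..n} \<Longrightarrow> s i \<otimes> s i = \<one>"
    and one_word: "w0 \<in> W" "m w0 = \<one>"
    and model_inj: "inj_on m W"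
    and act_closed: "i \<in> {1..n} \<Longrightarrow> w \<in> W \<Longrightarrow> act i w \<in> W"
    and act_act: "i \<in> {1..n} \<Longrightarrow> w \<in> W \<Longrightarrow> act i (act i w) = w"
    and model_act: "i \<in> {1..n} \<Longrightarrow> w \<in> W \<Longrightarrow> m (act i w) = m w \<otimes> s i"
    and finite_roots: "finite \<Phi>"
    and root_in: "i \<in> {1..n} \<Longrightarrow> root i \<in> \<Phi>"
    and t_closed: "i \<in> {1..n} \<Longrightarrow> r \<in> \<Phi> - {root i} \<Longrightarrow> t i r \<in> \<Phi> - {root i}"
    and t_t: "i \<in> {1..n} \<Longrightarrow> r \<in> \<Phi> - {root i} \<Longrightarrow> t i (t i r) = r"
    and neg_act: "i \<in> {1..n} \<Longrightarrow> w \<in> W \<Longrightarrow> r \<in> \<Phi> - {root i} \<Longrightarrow> neg (act i w) r \<longleftrightarrow> neg w (t i r)"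
    and neg_act_root: "i \<in> {1..n} \<Longrightarrow> w \<in> W \<Longrightarrow> neg (act i w) (root i) \<longleftrightarrow> \<not> neg w (root i)"
    and not_neg_one: "r \<in> \<Phi> \<Longrightarrow> \<not> neg w0 r"
    and no_descent: "w \<in> W \<Longrightarrow> (\<And>i. i \<in> {1..n} \<Longrightarrow> \<not> neg w (root i)) \<Longrightarrow> w = w0"
begin

definition inversions :: "'w \<Rightarrow> 'r set" where
  "inversions w = {r \<in> \<Phi>. neg w r}"

lemma finite_inversions: "finite (inversions w)"
  using finite_roots by (simp add: inversions_def)

text \<open>Away from the simple root, \<open>t i\<close> matches the inversions of the two words;
  the simple root is an inversion of exactly one of them.\<close>

lemma card_inversions_act:
  assumes i: "i \<in> {1..n}" and w: "w \<in> W"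
  shows "\<not> neg w (root i) \<Longrightarrow> card (inversions (act i w)) = Suc (card (inversions w))"
    and "neg w (root i) \<Longrightarrow> card (inversions w) = Suc (card (inversions (act i w)))"
proof -
  have "bij_betw (t i) (inversions (act i w) - {root i}) (inversions w - {root i})"
    using i w t_closed[OF i] t_t[OF i] neg_act[OF i w]
    by (intro bij_betwI[where g = "t i"]) (auto simp: inversions_def)
  then have eq: "card (inversions (act i w) - {root i}) = card (inversions w - {root i})"
    by (rule bij_betw_same_card)
  have mem: "root i \<in> inversions (act i w) \<longleftrightarrow> \<not> neg w (root i)" "root i \<in> inversions w \<longleftrightarrow> neg w (root i)"
    using i w root_in neg_act_root by (auto simp: inversions_def)
  show "\<not> neg w (root i) \<Longrightarrow> card (inversions (act i w)) = Suc (card (inversions w))"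
    using mem eq card_Suc_Diff1[OF finite_inversions, of "root i" "act i w"] by simp
  show "neg w (root i) \<Longrightarrow> card (inversions w) = Suc (card (inversions (act i w)))"
    using mem eq card_Suc_Diff1[OF finite_inversions, of "root i" w] by simp
qed

lemma word_prod_closed: "set ls \<subseteq> {1..n} \<Longrightarrow> word_prod G s ls \<in> carrier G"
  by (induction ls) (auto simp: word_prod_def gen_closed)

lemma word_prod_append:
  "set ls \<subseteq> {1..n} \<Longrightarrow> set ls' \<subseteq> {1..n} \<Longrightarrow>
    word_prod G s (ls @ ls') = word_prod G s ls \<otimes> word_prod G s ls'"
proof (induction ls)
  case Nil
  then show ?case using word_prod_closed[of ls'] by (simp add: word_prod_def)
next
  case (Cons i ls)
  then show ?case using word_prod_closed[of ls] word_prod_closed[of ls'] gen_closed[of i]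
    by (simp add: word_prod_def m_assoc)
qed

lemma word_prod_single: "i \<in> {1..n} \<Longrightarrow> word_prod G s [i] = s i"
  by (simp add: word_prod_def gen_closed)

text \<open>Sorting: as long as \<open>w\<close> is not \<open>w0\<close>, some simple root is sent
  to a negative one, and the corresponding generator removes exactly one inversion.\<close>

lemma word_of_model:
  assumes "w \<in> W"
  shows "\<exists>ls. set ls \<subseteq> {1..n} \<and> length ls = card (inversions w) \<and> word_prod G s ls = m w"
  using assms
proof (induction "card (inversions w)" arbitrary: w)
  case 0
  then have "inversions w = {}" using finite_inversions by simp
  then have "\<not> neg w (root i)" if "i \<in> {1..n}" for i
    using root_in[OF that] by (auto simp: inversions_def)
  then have "w = w0" using no_descent 0 by blast
  then show ?case using 0 one_word by (intro exI[of _ "[]"]) (simp add: word_prod_def)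
next
  case (Suc k)
  have "w \<noteq> w0"
  proof
    assume "w = w0"
    then have "inversions w = {}" using not_neg_one by (auto simp: inversions_def)
    then show False using Suc(2) by simp
  qed
  then obtain i where i: "i \<in> {1..n}" "neg w (root i)"
    using no_descent Suc.prems by blast
  then have k: "k = card (inversions (act i w))"
    using card_inversions_act(2)[OF i(1) Suc.prems i(2)] Suc(2) by simp
  obtain ls where ls: "set ls \<subseteq> {1..n}" "length ls = k" "word_prod G s ls = m (act i w)"
    using Suc(1)[OF k act_closed[OF i(1) Suc.prems]] k by auto
  have "m w = m (act i w) \<otimes> s i"
    using model_act[OF i(1) act_closed[OF i(1) Suc.prems]] act_act[OF i(1) Suc.prems] by simp
  then show ?case
    using ls i(1) Suc(2)
    by (intro exI[of _ "ls @ [i]"]) (simp add: word_prod_append word_prod_single)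
qed

text \<open>The opposite bound: a generator adds at most one inversion.\<close>

lemma model_of_word:
  assumes "set ls \<subseteq> {1..n}"
  shows "\<exists>w\<in>W. word_prod G s ls = m w \<and> card (inversions w) \<le> length ls"
  using assms
proof (induction ls rule: rev_induct)
  case Nil
  have "inversions w0 = {}" using not_neg_one by (auto simp: inversions_def)
  then show ?case using one_word by (intro bexI[of _ w0]) (simp_all add: word_prod_def)
next
  case (snoc i ls)
  then obtain w where w: "w \<in> W" "word_prod G s ls = m w" "card (inversions w) \<le> length ls" by auto
  have i: "i \<in> {1..n}" using snoc by simp
  have "card (inversions (act i w)) \<le> Suc (length ls)"
    using card_inversions_act[OF i w(1)] w(3) by (cases "neg w (root i)") auto
  moreover have "word_prod G s (ls @ [i]) = m (act i w)"
    using snoc w i model_act[OF i w(1)] by (simp add: word_prod_append word_prod_single)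
  ultimately show ?case using act_closed[OF i w(1)] by (intro bexI[of _ "act i w"]) auto
qed

lemma coxeter_length_model:
  assumes "w \<in> W"
  shows "coxeter_length G s n (m w) = card (inversions w)"
  unfolding coxeter_length_def
proof (rule Least_equality)
  show "\<exists>ls. length ls = card (inversions w) \<and> set ls \<subseteq> {1..n} \<and> word_prod G s ls = m w"
    using word_of_model[OF assms] by blast
next
  fix k assume "\<exists>ls. length ls = k \<and> set ls \<subseteq> {1..n} \<and> word_prod G s ls = m w"
  then obtain ls where ls: "length ls = k" "set ls \<subseteq> {1..n}" "word_prod G s ls = m w" by blast
  then obtain w' where "w' \<in> W" "m w = m w'" "card (inversions w') \<le> k"
    using model_of_word[OF ls(2)] by auto
  with model_inj assms show "card (inversions w) \<le> k" by (auto dest: inj_onD)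
qed

lemma descents_model:
  assumes "w \<in> W"
  shows "descents G s n (m w) = {i \<in> {1..n}. neg w (root i)}"
proof -
  have "coxeter_length G s n (m w \<otimes> s i) < coxeter_length G s n (m w) \<longleftrightarrow> neg w (root i)"
    if i: "i \<in> {1..n}" for i
    unfolding model_act[OF i assms, symmetric] coxeter_length_model[OF assms]
      coxeter_length_model[OF act_closed[OF i assms]]
    using card_inversions_act[OF i assms] by (cases "neg w (root i)") auto
  then show ?thesis by (auto simp: descents_def)
qed

text \<open>The generators are involutions, so words in them already exhaust the subgroup, and words
  correspond to the model.\<close>

lemma carrier_generated: "carrier (subgroup_generated G (s ` {1..n})) = m ` W"
proof (rule subset_antisym)
  have S: "carrier G \<inter> s ` {1..n} = s ` {1..n}" using gen_closed by auto
  show "carrier (subgroup_generated G (s ` {1..n})) \<subseteq> m ` W"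
  proof
    fix x assume "x \<in> carrier (subgroup_generated G (s ` {1..n}))"
    then have "x \<in> generate G (s ` {1..n})" unfolding carrier_subgroup_generated S .
    then have "\<exists>ls. set ls \<subseteq> {1..n} \<and> x = word_prod G s ls"
    proof induction
      case one
      then show ?case by (intro exI[of _ "[]"]) (simp add: word_prod_def)
    next
      case (incl h)
      then obtain i where "i \<in> {1..n}" "h = s i" by auto
      then show ?case by (intro exI[of _ "[i]"]) (simp add: word_prod_single)
    next
      case (inv h)
      then obtain i where i: "i \<in> {1..n}" "h = s i" by auto
      then have "inv h = s i" using gen_square gen_closed by (simp add: inv_equality)
      with i show ?case by (intro exI[of _ "[i]"]) (simp add: word_prod_single)
    next
      case (eng h1 h2)
      then obtain ls ls' where "set ls \<subseteq> {1..n}" "h1 = word_prod G s ls"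
        "set ls' \<subseteq> {1..n}" "h2 = word_prod G s ls'" by blast
      then show ?case by (intro exI[of _ "ls @ ls'"]) (simp add: word_prod_append)
    qed
    then show "x \<in> m ` W" using model_of_word by blast
  qed
  have "word_prod G s ls \<in> generate G (s ` {1..n})" if "set ls \<subseteq> {1..n}" for ls
    using that
  proof (induction ls)
    case (Cons i ls)
    then have "s i \<in> generate G (s ` {1..n})" by (intro generate.incl) auto
    with Cons show ?case by (auto simp: word_prod_def intro: generate.eng)
  qed (simp add: word_prod_def generate.one)
  then show "m ` W \<subseteq> carrier (subgroup_generated G (s ` {1..n}))"
    unfolding carrier_subgroup_generated S using word_of_model by force
qed

end

text \<open>Length refers only to multiplication and unit, which the generated subgroup inherits.
  Thus the model can live in the ambient group.\<close>

lemma coxeter_length_subgroup_generated: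
  "coxeter_length (subgroup_generated G A) = coxeter_length G"
  by (simp add: coxeter_length_def word_prod_def fun_eq_iff)

lemma descents_subgroup_generated:
  "descents (subgroup_generated G A) = descents G"
  by (simp add: descents_def coxeter_length_subgroup_generated fun_eq_iff)

lemma affine_descents_subgroup_generated:
  "affine_descents (subgroup_generated G A) = affine_descents G"
  by (simp add: affine_descents_def descents_subgroup_generated coxeter_length_subgroup_generated fun_eq_iff)

lemma ascents_rev: "ascents (rev xs) = card {i. Suc i < length xs \<and> xs ! Suc i < xs ! i}"
proof -
  have "bij_betw (\<lambda>i. length xs - 2 - i) {i. Suc i < length (rev xs) \<and> rev xs ! i < rev xs ! Suc i}
      {i. Suc i < length xs \<and> xs ! Suc i < xs ! i}"
    by (rule bij_betwI[where g = "\<lambda>i. length xs - 2 - i"])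
      (auto simp: rev_nth Suc_diff_Suc numeral_2_eq_2)
  then show ?thesis by (simp add: ascents_conv_card bij_betw_same_card)
qed

lemma keyed_lists_rev: "rev xs \<in> keyed_lists \<kappa> S \<longleftrightarrow> xs \<in> keyed_lists \<kappa> S"
  by (simp add: keyed_lists_def flip: rev_map)

text \<open>Letters may change within their key: for \<open>id\<close> this is a mere rearrangement,
  for \<open>abs\<close> it admits sign changes.\<close>

lemma keyed_lists_permute:
  assumes "w \<in> keyed_lists \<kappa> S" "\<sigma> permutes {..<length w}"
    and "\<And>p. p < length w \<Longrightarrow> \<kappa> (f p) = \<kappa> (w ! \<sigma> p)"
  shows "map f [0..<length w] \<in> keyed_lists \<kappa> S"
proof -
  have "map \<kappa> (map f [0..<length w]) = permute_list \<sigma> (map \<kappa> w)"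
    using assms(3) permutes_in_image[OF assms(2)]
    by (intro nth_equalityI) (auto simp: permute_list_def)
  then have "mset (map \<kappa> (map f [0..<length w])) = mset (map \<kappa> w)"
    using assms(2) by (simp only: mset_permute_list length_map)
  then have "distinct (map \<kappa> (map f [0..<length w])) = distinct (map \<kappa> w)"
    "set (map \<kappa> (map f [0..<length w])) = set (map \<kappa> w)"
    by (metis mset_eq_imp_distinct_iff, metis mset_eq_setD)
  then show ?thesis
    using assms(1) unfolding keyed_lists_def by (simp only: set_map mem_Collect_eq)
qed

section \<open>Type A in one-line notation\<close>

definition list_perm :: "nat list \<Rightarrow> nat \<Rightarrow> nat" where
  "list_perm w = (\<lambda>i. if i \<in> {1..length w} then w ! (i - 1) else i)"

lemma list_perm_bij: "bij_betw list_perm (keyed_lists id {1..N}) {p. p permutes {1..N}}"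
proof (rule bij_betwI[where g = "\<lambda>p. map p [1..<Suc N]"])
  show "list_perm \<in> keyed_lists id {1..N} \<rightarrow> {p. p permutes {1..N}}"
  proof
    fix w assume w: "w \<in> keyed_lists id {1..N}"
    then have len: "length w = N" and w': "distinct w" "set w = {1..N}"
      using keyed_lists_length[OF w] by (auto simp: keyed_lists_def)
    have "bij_betw ((!) w) {..<N} {1..N}" using bij_betw_nth[OF w'(1)] len w'(2) by metis
    moreover have "bij_betw (\<lambda>i. i - 1) {1..N} {..<N}"
      by (rule bij_betwI[where g = Suc]) auto
    ultimately have "bij_betw ((!) w \<circ> (\<lambda>i. i - 1)) {1..N} {1..N}" by (rule bij_betw_trans[rotated])
    then have "bij_betw (list_perm w) {1..N} {1..N}"
      by (rule bij_betw_cong[THEN iffD1, rotated]) (simp add: list_perm_def len)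
    then have "list_perm w permutes {1..N}"
      by (rule bij_imp_permutes) (auto simp: list_perm_def len)
    then show "list_perm w \<in> {p. p permutes {1..N}}" by simp
  qed
  show "(\<lambda>p. map p [1..<Suc N]) \<in> {p. p permutes {1..N}} \<rightarrow> keyed_lists id {1..N}"
  proof
    fix p assume "p \<in> {p. p permutes {1..N}}"
    then have "p permutes {1..N}" by simp
    then have "inj_on p {1..N}" "p ` {1..N} = {1..N}" by (rule permutes_inj_on, rule permutes_image)
    then show "map p [1..<Suc N] \<in> keyed_lists id {1..N}"
      by (simp add: keyed_lists_def distinct_map atLeastLessThanSuc_atLeastAtMost del: upt_Suc)
  qed
  show "map (list_perm w) [1..<Suc N] = w" if "w \<in> keyed_lists id {1..N}" for w
    using keyed_lists_length[OF that]
    by (intro nth_equalityI) (auto simp: list_perm_def simp del: upt_Suc)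
  show "list_perm (map p [1..<Suc N]) = p" if "p \<in> {p. p permutes {1..N}}" for p
    using that by (auto simp: list_perm_def fun_eq_iff permutes_def simp del: upt_Suc)
qed

text \<open>Positions count from 0, so generator i exchanges positions i - 1 and i. Exchanging
  neighbours keeps every pair of positions in order except the pair exchanged.\<close>

lemma root_words_A:
  fixes N :: nat
  shows "root_words (sym_group N) (\<lambda>i. transpose i (i + 1)) (N - 1)
    (keyed_lists id {1..N}) [1..<Suc N] list_perm
    (\<lambda>i w. map (\<lambda>p. w ! transpose (i - 1) i p) [0..<N])
    {(p, q). p < q \<and> q < N} (\<lambda>i. (i - 1, i))
    (\<lambda>i (p, q). (transpose (i - 1) i p, transpose (i - 1) i q))
    (\<lambda>w (p, q). w ! q < w ! p)"
proof -
  interpret group "sym_group N" by (rule sym_group_is_group)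
  have len: "length w = N" if "w \<in> keyed_lists id {1..N}" for w
    using keyed_lists_length[OF that] by simp
  show ?thesis
  proof (unfold_locales, goal_cases)
    case (1 i)
    then show ?case by (auto simp: sym_group_def intro!: permutes_swap_id)
  next
    case (2 i)
    then show ?case by (simp add: sym_group_def)
  next
    case 3
    then show ?case by (auto simp: keyed_lists_def simp del: upt_Suc)
  next
    case 4
    then show ?case by (auto simp: sym_group_def list_perm_def fun_eq_iff simp del: upt_Suc)
  next
    case 5
    then show ?case using list_perm_bij by (rule bij_betw_imp_inj_on)
  next
    case (6 i w)
    have "transpose (i - 1) i permutes {..<length w}"
      using 6 len[OF 6(2)] by (intro permutes_swap_id) auto
    from keyed_lists_permute[OF 6(2) this, of "\<lambda>p. w ! transpose (i - 1) i p"]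
    show ?case using len[OF 6(2)] by simp
  next
    case (7 i w)
    then show ?case using len[OF 7(2)]
      by (intro nth_equalityI) (auto simp: transpose_def)
  next
    case (8 i w)
    then show ?case using len[OF 8(2)]
      by (auto simp: list_perm_def sym_group_def fun_eq_iff transpose_def)
  next
    case 9
    show ?case by (rule finite_subset[of _ "{..<N} \<times> {..<N}"]) auto
  next
    case (10 i)
    then show ?case by auto
  next
    case (11 i r)
    then show ?case by (cases r) (auto simp: transpose_def split: if_splits)
  next
    case (12 i r)
    then show ?case by (cases r) auto
  next
    case (13 i w r)
    then show ?case by (cases r) (auto simp: transpose_def)
  next
    case (14 i w)
    then have "w ! (i - 1) \<noteq> w ! i"
      using len[OF 14(2)] by (auto simp: keyed_lists_def nth_eq_iff_index_eq)
    with 14 show ?case by auto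
  next
    case (15 r)
    then show ?case by (auto simp del: upt_Suc)
  next
    case (16 w)
    have "sorted w"
      unfolding sorted_iff_nth_Suc
    proof (intro allI impI)
      fix i assume "Suc i < length w"
      then have "Suc i \<in> {1..N - 1}" using len[OF 16(1)] by auto
      from 16(2)[OF this] show "w ! i \<le> w ! Suc i" by simp
    qed
    moreover have "distinct w" "set w = {1..N}" using 16(1) by (simp_all add: keyed_lists_def)
    moreover have "sorted [1..<Suc N]" "distinct [1..<Suc N]" "set [1..<Suc N] = {1..N}"
      by (auto simp del: upt_Suc)
    ultimately show ?case by (metis sorted_distinct_set_unique)
  qed
qed

lemma eulerian_A_conv: "eulerian_A m = (eulerian_rec (Suc m) :: 'a::field_char_0 poly)"
proof -
  interpret root_words "sym_group (m + 1)" "\<lambda>i. transpose i (i + 1)" m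
    "keyed_lists id {1..Suc m}" "[1..<Suc (Suc m)]" list_perm
    "\<lambda>i w. map (\<lambda>p. w ! transpose (i - 1) i p) [0..<Suc m]"
    "{(p, q). p < q \<and> q < Suc m}" "\<lambda>i. (i - 1, i)"
    "\<lambda>i (p, q). (transpose (i - 1) i p, transpose (i - 1) i q)"
    "\<lambda>w (p, q). w ! q < w ! p"
    using root_words_A[of "Suc m"] by simp
  have card: "card (descents (sym_group (m + 1)) (\<lambda>i. transpose i (i + 1)) m (list_perm w)) = ascents (rev w)"
    if w: "w \<in> keyed_lists id {1..Suc m}" for w
  proof -
    have "bij_betw Suc {i. Suc i < length w \<and> w ! Suc i < w ! i} {i \<in> {1..m}. w ! i < w ! (i - 1)}"
      using keyed_lists_length[OF w] by (intro bij_betwI[where g = "\<lambda>i. i - 1"]) auto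
    from bij_betw_same_card[OF this] show ?thesis
      unfolding descents_model[OF w] ascents_rev by simp
  qed
  have bij: "bij_betw list_perm (keyed_lists id {1..Suc m}) (carrier (sym_group (m + 1)))"
    using list_perm_bij[of "Suc m"] by (simp add: sym_group_def)
  have "eulerian_A m = (\<Sum>w\<in>keyed_lists id {1..Suc m}. Polynomial.monom (1::'a)
      (card (descents (sym_group (m + 1)) (\<lambda>i. transpose i (i + 1)) m (list_perm w))))"
    unfolding eulerian_A_def eulerian_poly_def by (rule sum.reindex_bij_betw[OF bij, symmetric])
  also have "\<dots> = (\<Sum>w\<in>keyed_lists id {1..Suc m}. Polynomial.monom (1::'a) (ascents (rev w)))"
    by (intro sum.cong refl) (simp only: card)
  also have "\<dots> = (\<Sum>w\<in>keyed_lists id {1..Suc m}. Polynomial.monom (1::'a) (ascents w))"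
    by (rule sum.reindex_bij_witness[where i = rev and j = rev]) (simp_all add: keyed_lists_rev)
  also have "\<dots> = eulerian_rec (Suc m)"
    by (simp add: sum_monom_ascents_perms)
  finally show ?thesis .
qed

section \<open>Signed permutation matrices\<close>

lemma general_linear_group_is_group: "group (general_linear_group n)"
proof -
  interpret ring "ring_mat TYPE(real) n ()" by (rule ring_mat)
  show ?thesis unfolding general_linear_group_def by (rule units_group)
qed

lemma general_linear_group_simps:
  "mult (general_linear_group n) = (*)" "one (general_linear_group n) = 1\<^sub>m n"
  by (simp_all add: general_linear_group_def units_of_def ring_mat_simps)

lemma involution_in_general_linear_group:
  "A \<in> carrier_mat n n \<Longrightarrow> A * A = 1\<^sub>m n \<Longrightarrow> A \<in> carrier (general_linear_group n)"
  by (auto simp: general_linear_group_def units_of_def Units_def ring_mat_simps)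

definition monomial_mat :: "nat \<Rightarrow> (nat \<Rightarrow> nat) \<Rightarrow> (nat \<Rightarrow> real) \<Rightarrow> real mat" where
  "monomial_mat n \<sigma> \<epsilon> = mat n n (\<lambda>(i, j). if i = \<sigma> j then \<epsilon> j else 0)"

lemma monomial_mat_carrier: "monomial_mat n \<sigma> \<epsilon> \<in> carrier_mat n n"
  by (simp add: monomial_mat_def)

lemma mult_monomial_mat_index:
  assumes "A \<in> carrier_mat n n" "i < n" "j < n" "\<sigma> j < n"
  shows "(A * monomial_mat n \<sigma> \<epsilon>) $$ (i, j) = A $$ (i, \<sigma> j) * \<epsilon> j"
  using assms by (simp add: monomial_mat_def scalar_prod_def if_distrib cong: if_cong)

lemma monomial_mat_square:
  assumes "\<And>j. j < n \<Longrightarrow> \<sigma> j < n" "\<And>j. j < n \<Longrightarrow> \<sigma> (\<sigma> j) = j" "\<And>j. j < n \<Longrightarrow> \<epsilon> (\<sigma> j) * \<epsilon> j = 1"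
  shows "monomial_mat n \<sigma> \<epsilon> * monomial_mat n \<sigma> \<epsilon> = 1\<^sub>m n"
proof (rule eq_matI)
  fix i j assume "i < dim_row (1\<^sub>m n :: real mat)" "j < dim_col (1\<^sub>m n :: real mat)"
  then have ij: "i < n" "j < n" by simp_all
  have "(monomial_mat n \<sigma> \<epsilon> * monomial_mat n \<sigma> \<epsilon>) $$ (i, j) = monomial_mat n \<sigma> \<epsilon> $$ (i, \<sigma> j) * \<epsilon> j"
    using ij assms(1) by (intro mult_monomial_mat_index monomial_mat_carrier) auto
  also have "\<dots> = 1\<^sub>m n $$ (i, j)"
    using ij assms by (simp add: monomial_mat_def)
  finally show "(monomial_mat n \<sigma> \<epsilon> * monomial_mat n \<sigma> \<epsilon>) $$ (i, j) = 1\<^sub>m n $$ (i, j)" .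
qed (simp_all add: monomial_mat_def)

lemma reflection_mat_minus:
  assumes "i < n" "j < n" "i \<noteq> j"
  shows "reflection_mat n (unit_vec n i - unit_vec n j) = monomial_mat n (transpose i j) (\<lambda>_. 1)"
proof -
  let ?a = "unit_vec n i - unit_vec n j :: real vec"
  have a: "?a $ k = (if k = i then 1 else 0) - (if k = j then 1 else 0)" if "k < n" for k
    using that assms by simp
  have "?a \<bullet> ?a = (\<Sum>k\<in>{0..<n}. (if k = i then 1 else 0) + (if k = j then 1 else 0))"
    unfolding scalar_prod_def using assms by (intro sum.cong) auto
  also have "\<dots> = 2" using assms by (simp add: sum.distrib)
  finally have "?a \<bullet> ?a = 2" .
  then show ?thesis
    using assms by (intro eq_matI) (auto simp: reflection_mat_def monomial_mat_def a transpose_def)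
qed

lemma reflection_mat_plus:
  assumes "i < n" "j < n" "i \<noteq> j"
  shows "reflection_mat n (unit_vec n i + unit_vec n j)
    = monomial_mat n (transpose i j) (\<lambda>k. if k = i \<or> k = j then - 1 else 1)"
proof -
  let ?a = "unit_vec n i + unit_vec n j :: real vec"
  have a: "?a $ k = (if k = i then 1 else 0) + (if k = j then 1 else 0)" if "k < n" for k
    using that assms by simp
  have "?a \<bullet> ?a = (\<Sum>k\<in>{0..<n}. (if k = i then 1 else 0) + (if k = j then 1 else 0))"
    unfolding scalar_prod_def using assms by (intro sum.cong) auto
  also have "\<dots> = 2" using assms by (simp add: sum.distrib)
  finally have "?a \<bullet> ?a = 2" .
  then show ?thesis
    using assms by (intro eq_matI) (auto simp: reflection_mat_def monomial_mat_def a transpose_def)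
qed

lemma reflection_mat_unit:
  assumes "i < n"
  shows "reflection_mat n (unit_vec n i) = monomial_mat n id (\<lambda>k. if k = i then - 1 else 1)"
proof -
  have "unit_vec n i \<bullet> unit_vec n i = (1 :: real)" using assms by simp
  then show ?thesis
    using assms by (intro eq_matI) (auto simp: reflection_mat_def monomial_mat_def)
qed

section \<open>Signed words, their matrices and the encoding of roots\<close>

abbreviation signed_words :: "nat \<Rightarrow> real list set" where
  "signed_words n \<equiv> keyed_lists abs (real ` {1..n})"

text \<open>The word of the identity. It is strictly decreasing and positive, hence positive on all
  positive roots of types B and D.\<close>

definition top_word :: "nat \<Rightarrow> real list" where
  "top_word n = map (\<lambda>p. real (n - p)) [0..<n]"

text \<open>
  The matrix \<open>\<sigma>\<close> with \<open>\<rho>\<^sup>T \<sigma> = w\<close>, where \<open>\<rho> = (n, \<dots>, 1)\<close>.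
\<close>

definition word_mat :: "nat \<Rightarrow> real list \<Rightarrow> real mat" where
  "word_mat n w = mat n n (\<lambda>(i, j). if \<bar>w ! j\<bar> = real (n - i) then sgn (w ! j) else 0)"

text \<open>The row vector \<open>w\<close> multiplied on the right by
  \<open>monomial_mat n \<sigma> \<epsilon>\<close>.\<close>

definition word_act :: "nat \<Rightarrow> (nat \<Rightarrow> nat) \<Rightarrow> (nat \<Rightarrow> real) \<Rightarrow> real list \<Rightarrow> real list" where
  "word_act n \<sigma> \<epsilon> w = map (\<lambda>p. \<epsilon> p * w ! \<sigma> p) [0..<n]"

lemma length_signed_word: "w \<in> signed_words n \<Longrightarrow> length w = n"
  by (simp add: keyed_lists_length card_image)

lemma signed_word_nth:
  assumes "w \<in> signed_words n" "p < n"
  shows "\<bar>w ! p\<bar> \<in> real ` {1..n}" "w ! p \<noteq> 0" "q < n \<Longrightarrow> \<bar>w ! p\<bar> = \<bar>w ! q\<bar> \<longleftrightarrow> p = q"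
proof -
  note len = length_signed_word[OF assms(1)]
  show "\<bar>w ! p\<bar> \<in> real ` {1..n}"
    using assms len by (metis (mono_tags, lifting) image_eqI keyed_lists_def mem_Collect_eq nth_mem)
  then show "w ! p \<noteq> 0" by auto
  have "distinct (map abs w)" using assms by (simp add: keyed_lists_def del: distinct_map)
  then show "\<bar>w ! p\<bar> = \<bar>w ! q\<bar> \<longleftrightarrow> p = q" if "q < n"
    using nth_eq_iff_index_eq[of "map abs w" p q] that assms len by simp
qed

lemma word_act_closed:
  assumes "w \<in> signed_words n" "\<sigma> permutes {..<n}" "\<And>p. \<bar>\<epsilon> p\<bar> = 1"
  shows "word_act n \<sigma> \<epsilon> w \<in> signed_words n"
  using keyed_lists_permute[OF assms(1), of \<sigma> "\<lambda>p. \<epsilon> p * w ! \<sigma> p"] assms(2,3) length_signed_word[OF assms(1)]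
  by (simp add: word_act_def abs_mult)

lemma word_mat_act:
  assumes "w \<in> signed_words n" "\<sigma> permutes {..<n}" "\<And>p. \<bar>\<epsilon> p\<bar> = 1"
  shows "word_mat n (word_act n \<sigma> \<epsilon> w) = word_mat n w * monomial_mat n \<sigma> \<epsilon>"
proof (rule eq_matI)
  fix i j assume "i < dim_row (word_mat n w * monomial_mat n \<sigma> \<epsilon>)" "j < dim_col (word_mat n w * monomial_mat n \<sigma> \<epsilon>)"
  then have ij: "i < n" "j < n" by (simp_all add: word_mat_def monomial_mat_def)
  then have j': "\<sigma> j < n" using permutes_in_image[OF assms(2)] by auto
  have "sgn (\<epsilon> j) = \<epsilon> j" using assms(3)[of j] by (auto simp: sgn_if abs_if split: if_splits)
  then show "word_mat n (word_act n \<sigma> \<epsilon> w) $$ (i, j) = (word_mat n w * monomial_mat n \<sigma> \<epsilon>) $$ (i, j)"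
    using ij j' assms(3)
    by (subst mult_monomial_mat_index) (auto simp: word_mat_def word_act_def abs_mult sgn_mult)
qed (simp_all add: word_mat_def monomial_mat_def)

lemma word_mat_top_word: "word_mat n (top_word n) = 1\<^sub>m n"
  by (rule eq_matI) (auto simp: word_mat_def top_word_def)

lemma word_mat_inj: "inj_on (word_mat n) (signed_words n)"
proof (rule inj_onI)
  fix v w assume v: "v \<in> signed_words n" and w: "w \<in> signed_words n" and eq: "word_mat n v = word_mat n w"
  show "v = w"
  proof (rule nth_equalityI)
    fix j assume "j < length v"
    then have j: "j < n" using length_signed_word[OF v] by simp
    obtain k where k: "k \<in> {1..n}" "\<bar>v ! j\<bar> = real k" using signed_word_nth(1)[OF v j] by auto
    then have "\<bar>v ! j\<bar> = real (n - (n - k))" "n - k < n" by auto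
    moreover from this have "word_mat n v $$ (n - k, j) = sgn (v ! j)" using j by (simp add: word_mat_def)
    ultimately have "(if \<bar>w ! j\<bar> = \<bar>v ! j\<bar> then sgn (w ! j) else 0) = sgn (v ! j)"
      unfolding eq using j by (simp add: word_mat_def)
    moreover have "sgn (v ! j) \<noteq> 0" using signed_word_nth(2)[OF v j] by (simp add: sgn_zero_iff)
    ultimately have "\<bar>w ! j\<bar> = \<bar>v ! j\<bar>" "sgn (w ! j) = sgn (v ! j)" by (auto split: if_splits)
    then show "v ! j = w ! j" by (metis sgn_mult_abs)
  qed (simp add: length_signed_word[OF v] length_signed_word[OF w])
qed

lemma top_word_signed: "top_word n \<in> signed_words n"
proof -
  have "real ` {1..n} = (\<lambda>p. real (n - p)) ` {0..<n}"
  proof (intro subset_antisym subsetI)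
    fix x assume "x \<in> real ` {1..n}"
    then obtain k where "k \<in> {1..n}" "x = real k" by auto
    then show "x \<in> (\<lambda>p. real (n - p)) ` {0..<n}" by (intro image_eqI[of _ _ "n - k"]) auto
  next
    fix x assume "x \<in> (\<lambda>p. real (n - p)) ` {0..<n}"
    then obtain p where "p < n" "x = real (n - p)" by auto
    then show "x \<in> real ` {1..n}" by (intro image_eqI[of _ _ "n - p"]) auto
  qed
  then show ?thesis
    by (auto simp: keyed_lists_def top_word_def distinct_map inj_on_def image_image)
qed

text \<open>A decreasing word with nonnegative last letter has no negative letters, so it lists 1 to
  n in decreasing order. This is the absence of descents in type B; type D is reduced to it.\<close>

lemma decreasing_word_unique:
  assumes w: "w \<in> signed_words n" and dec: "\<And>p. Suc p < n \<Longrightarrow> w ! Suc p \<le> w ! p"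
    and last: "\<And>p. Suc p = n \<Longrightarrow> 0 \<le> w ! p"
  shows "w = top_word n"
proof -
  have *: "sorted (rev w) \<and> distinct (rev w) \<and> set (rev w) = real ` {1..n}"
    if w: "w \<in> signed_words n" and dec: "\<And>p. Suc p < n \<Longrightarrow> w ! Suc p \<le> w ! p"
      and last: "\<And>p. Suc p = n \<Longrightarrow> 0 \<le> w ! p" for w
  proof -
    note len = length_signed_word[OF w]
    have sorted: "sorted (rev w)" unfolding sorted_rev_iff_nth_Suc using dec len by simp
    have "0 \<le> x" if x: "x \<in> set w" for x
    proof -
      obtain p where p: "p < n" "x = w ! p" using x len by (auto simp: in_set_conv_nth)
      have "w ! (n - 1) \<le> w ! p" using p len by (intro sorted_rev_nth_mono[OF sorted]) auto
      moreover have "0 \<le> w ! (n - 1)" using last[of "n - 1"] p by simp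
      ultimately show ?thesis using p by simp
    qed
    then have "map abs w = w" by (intro map_idI) auto
    moreover have "distinct (map abs w)" "set (map abs w) = real ` {1..n}"
      using w by (simp_all add: keyed_lists_def del: distinct_map)
    ultimately show ?thesis using sorted by simp
  qed
  have "rev w = rev (top_word n)"
    using *[OF w dec last] *[OF top_word_signed]
    by (intro sorted_distinct_set_unique) (auto simp: top_word_def)
  then show ?thesis by simp
qed

text \<open>
  The triple \<open>(p, q, e)\<close> encodes the root \<open>e\<^sub>p + e\<^sub>q\<close> or \<open>e\<^sub>p - e\<^sub>q\<close>, depending on \<open>e\<close>; with \<open>p = q\<close>
  the former stands for the short root \<open>e\<^sub>p\<close>.
\<close>

definition root_val :: "real list \<Rightarrow> nat \<times> nat \<times> bool \<Rightarrow> real" where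
  "root_val w = (\<lambda>(p, q, e). if e then w ! p + w ! q else w ! p - w ! q)"

definition pos_roots_D :: "nat \<Rightarrow> (nat \<times> nat \<times> bool) set" where
  "pos_roots_D n = {(p, q, e). p < q \<and> q < n}"

definition pos_roots_B :: "nat \<Rightarrow> (nat \<times> nat \<times> bool) set" where
  "pos_roots_B n = {(p, q, e). (p < q \<or> p = q \<and> e) \<and> q < n}"

definition simple_B :: "nat \<Rightarrow> nat \<Rightarrow> nat \<times> nat \<times> bool" where
  "simple_B n i = (if i < n then (i - 1, i, False) else (n - 1, n - 1, True))"

definition simple_D :: "nat \<Rightarrow> nat \<Rightarrow> nat \<times> nat \<times> bool" where
  "simple_D n i = (if i < n then (i - 1, i, False) else (n - 2, n - 1, True))"

text \<open>A sum is symmetric in its indices and is re-sorted to fit the encoding. A difference of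
  a positive root stays in order unless it is the simple root itself.\<close>

definition swap_root :: "nat \<Rightarrow> nat \<times> nat \<times> bool \<Rightarrow> nat \<times> nat \<times> bool" where
  "swap_root i = (\<lambda>(p, q, e). let p' = transpose (i - 1) i p; q' = transpose (i - 1) i q in
     if e then (min p' q', max p' q', True) else (p', q', False))"

definition refl_root_B :: "nat \<Rightarrow> nat \<Rightarrow> nat \<times> nat \<times> bool \<Rightarrow> nat \<times> nat \<times> bool" where
  "refl_root_B n i = (if i < n then swap_root i else (\<lambda>(p, q, e).
     if q = n - 1 then (p, q, \<not> e) else (p, q, e)))"

text \<open>For i = n the reflection sends each of the last two basis vectors to the negative of the
  other. It thus exchanges them and the sign in roots that involve just one of them, and fixes their
  difference.\<close>

definition refl_root_D :: "nat \<Rightarrow> nat \<Rightarrow> nat \<times> nat \<times> bool \<Rightarrow> nat \<times> nat \<times> bool" where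
  "refl_root_D n i = (if i < n then swap_root i else (\<lambda>(p, q, e).
     if p < n - 2 \<and> q = n - 1 then (p, n - 2, \<not> e)
     else if p < n - 2 \<and> q = n - 2 then (p, n - 1, \<not> e) else (p, q, e)))"

definition act_B :: "nat \<Rightarrow> nat \<Rightarrow> real list \<Rightarrow> real list" where
  "act_B n i = (if i < n then word_act n (transpose (i - 1) i) (\<lambda>_. 1)
     else word_act n id (\<lambda>k. if k = n - 1 then - 1 else 1))"

definition act_D :: "nat \<Rightarrow> nat \<Rightarrow> real list \<Rightarrow> real list" where
  "act_D n i = (if i < n then word_act n (transpose (i - 1) i) (\<lambda>_. 1)
     else word_act n (transpose (n - 2) (n - 1)) (\<lambda>k. if k = n - 2 \<or> k = n - 1 then - 1 else 1))"

lemma word_act_nth: "p < n \<Longrightarrow> word_act n \<sigma> \<epsilon> w ! p = \<epsilon> p * w ! \<sigma> p"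
  by (simp add: word_act_def)

lemma word_act_word_act:
  assumes "length w = n" "\<And>p. p < n \<Longrightarrow> \<sigma> p < n" "\<And>p. p < n \<Longrightarrow> \<sigma> (\<sigma> p) = p"
    "\<And>p. p < n \<Longrightarrow> \<epsilon> p * \<epsilon> (\<sigma> p) = 1"
  shows "word_act n \<sigma> \<epsilon> (word_act n \<sigma> \<epsilon> w) = w"
  using assms by (intro nth_equalityI) (auto simp: word_act_def simp flip: mult.assoc)

text \<open>Shared by types B and D, which have their first n - 1 generators in common.\<close>

lemma swap_root:
  assumes i: "i \<in> {1..<n}" and r: "r \<in> pos_roots_B n - {(i - 1, i, False)}"
  shows "swap_root i r \<in> pos_roots_B n - {(i - 1, i, False)}"
    and "r \<in> pos_roots_D n \<Longrightarrow> swap_root i r \<in> pos_roots_D n"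
    and "swap_root i (swap_root i r) = r"
    and "root_val (word_act n (transpose (i - 1) i) (\<lambda>_. 1) w) r = root_val w (swap_root i r)"
proof -
  obtain p q e where [simp]: "r = (p, q, e)" by (cases r)
  obtain j where j: "i = Suc j" using i by (cases i) auto
  note defs = swap_root_def pos_roots_B_def pos_roots_D_def root_val_def word_act_nth transpose_def min_def max_def
  show "swap_root i r \<in> pos_roots_B n - {(i - 1, i, False)}"
    using i r by (auto simp: defs j split: if_splits)
  show "r \<in> pos_roots_D n \<Longrightarrow> swap_root i r \<in> pos_roots_D n"
    using i r by (auto simp: defs j split: if_splits)
  show "swap_root i (swap_root i r) = r"
    using i r by (auto simp: defs j split: if_splits)
  show "root_val (word_act n (transpose (i - 1) i) (\<lambda>_. 1) w) r = root_val w (swap_root i r)"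
    using i r by (auto simp: defs j split: if_splits)
qed

lemma root_val_neq_0:
  assumes "w \<in> signed_words n" "r \<in> pos_roots_B n"
  shows "root_val w r \<noteq> 0"
proof -
  obtain p q e where r: "r = (p, q, e)" by (cases r)
  show ?thesis
  proof (cases "p = q")
    case True
    then show ?thesis using assms signed_word_nth(2)[OF assms(1)] by (auto simp: r root_val_def pos_roots_B_def)
  next
    case False
    then have "\<bar>w ! p\<bar> \<noteq> \<bar>w ! q\<bar>"
      using signed_word_nth(3)[OF assms(1), of p q] assms(2) by (auto simp: r pos_roots_B_def)
    then show ?thesis by (auto simp: r root_val_def)
  qed
qed

lemma pos_roots_D_subset: "pos_roots_D n \<subseteq> pos_roots_B n"
  by (auto simp: pos_roots_D_def pos_roots_B_def)

lemma finite_pos_roots_B: "finite (pos_roots_B n)"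
  by (rule finite_subset[of _ "{..<n} \<times> {..<n} \<times> UNIV"]) (auto simp: pos_roots_B_def)

lemma top_word_pos: "r \<in> pos_roots_B n \<Longrightarrow> root_val (top_word n) r > 0"
  by (auto simp: pos_roots_B_def root_val_def top_word_def)

section \<open>Inversion models of types B and D\<close>

lemma weyl_gen_B:
  assumes "i \<in> {1..n}"
  shows "weyl_gen n (simple_root_B n) i = (if i < n then monomial_mat n (transpose (i - 1) i) (\<lambda>_. 1)
     else monomial_mat n id (\<lambda>k. if k = n - 1 then - 1 else 1))"
  using assms by (auto simp: weyl_gen_def simple_root_B_def reflection_mat_minus reflection_mat_unit)

lemma weyl_gen_D:
  assumes "i \<in> {1..n}" "n \<ge> 2"
  shows "weyl_gen n (simple_root_D n) i = (if i < n then monomial_mat n (transpose (i - 1) i) (\<lambda>_. 1)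
     else monomial_mat n (transpose (n - 2) (n - 1)) (\<lambda>k. if k = n - 2 \<or> k = n - 1 then - 1 else 1))"
  using assms by (auto simp: weyl_gen_def simple_root_D_def reflection_mat_minus reflection_mat_plus)

lemma root_words_B:
  "root_words (general_linear_group n) (weyl_gen n (simple_root_B n)) n
    (signed_words n) (top_word n) (word_mat n) (act_B n) (pos_roots_B n) (simple_B n) (refl_root_B n)
    (\<lambda>w r. root_val w r < 0)"
proof -
  interpret group "general_linear_group n" by (rule general_linear_group_is_group)
  have sq: "weyl_gen n (simple_root_B n) i * weyl_gen n (simple_root_B n) i = 1\<^sub>m n" if "i \<in> {1..n}" for i
    using that unfolding weyl_gen_B[OF that]
    by (auto intro!: monomial_mat_square simp: transpose_def)
  have val: "root_val (act_B n i w) r = root_val w (refl_root_B n i r)"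
    if "i \<in> {1..n}" "r \<in> pos_roots_B n - {simple_B n i}" for i w r
  proof (cases "i < n")
    case True
    then show ?thesis using that swap_root(4)[of i n r w] by (simp add: act_B_def refl_root_B_def simple_B_def)
  next
    case False
    then show ?thesis using that
      by (cases r) (auto simp: act_B_def refl_root_B_def simple_B_def root_val_def pos_roots_B_def word_act_nth split: if_splits)
  qed
  have root_val_simple: "root_val (act_B n i w) (simple_B n i) = - root_val w (simple_B n i)"
    if "i \<in> {1..n}" for i w
    using that by (auto simp: act_B_def simple_B_def root_val_def word_act_nth)
  have perm: "transpose (i - 1) i permutes {..<n}" if "i < n" for i
    using that by (intro permutes_swap_id) auto
  show ?thesis
  proof (unfold_locales, goal_cases)
    case (1 i)
    then show ?case using sq[OF 1]
      by (intro involution_in_general_linear_group) (simp_all add: weyl_gen_B monomial_mat_carrier)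
  next
    case (2 i)
    then show ?case using sq[OF 2] by (simp add: general_linear_group_simps)
  next
    case 3
    then show ?case by (rule top_word_signed)
  next
    case 4
    then show ?case by (simp add: general_linear_group_simps word_mat_top_word)
  next
    case 5
    then show ?case by (rule word_mat_inj)
  next
    case (6 i w)
    then show ?case
      using word_act_closed[OF 6(2) perm] word_act_closed[OF 6(2) permutes_id] by (simp add: act_B_def)
  next
    case (7 i w)
    then show ?case using length_signed_word[of w n]
      by (auto simp: act_B_def transpose_def intro!: word_act_word_act)
  next
    case (8 i w)
    then show ?case
      using word_mat_act[OF 8(2) perm] word_mat_act[OF 8(2) permutes_id]
      by (simp add: act_B_def weyl_gen_B general_linear_group_simps)
  next
    case 9
    then show ?case by (rule finite_pos_roots_B)
  next
    case (10 i)
    then show ?case by (auto simp: simple_B_def pos_roots_B_def)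
  next
    case (11 i r)
    then show ?case using swap_root(1)[of i n r]
      by (cases r) (auto simp: refl_root_B_def simple_B_def pos_roots_B_def split: if_splits)
  next
    case (12 i r)
    then show ?case using swap_root(3)[of i n r]
      by (cases r) (auto simp: refl_root_B_def simple_B_def pos_roots_B_def split: if_splits)
  next
    case (13 i w r)
    then show ?case by (simp add: val)
  next
    case (14 i w)
    \<comment> \<open>The generator negates this value, and negation reverses negativity only for
      nonzero values.\<close>
    then have "root_val w (simple_B n i) \<noteq> 0"
      by (intro root_val_neq_0) (auto simp: simple_B_def pos_roots_B_def)
    with 14 show ?case by (auto simp: root_val_simple)
  next
    case (15 r)
    then show ?case using top_word_pos[of r n] by simp
  next
    case (16 w)
    show ?case
    proof (rule decreasing_word_unique[OF 16(1)])
      fix p assume "Suc p < n"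
      then show "w ! Suc p \<le> w ! p" using 16(2)[of "Suc p"] by (simp add: simple_B_def root_val_def)
    next
      fix p assume "Suc p = n"
      then show "0 \<le> w ! p" using 16(2)[of n] by (auto simp: simple_B_def root_val_def)
    qed
  qed
qed

text \<open>An even number of negative letters. As a product, this condition changes under
  \<open>word_act\<close> only by the product of the signs.\<close>

definition even_signed_words :: "nat \<Rightarrow> real list set" where
  "even_signed_words n = {w \<in> signed_words n. 0 < (\<Prod>p<n. w ! p)}"

lemma prod_word_act:
  assumes "\<sigma> permutes {..<n}"
  shows "(\<Prod>p<n. word_act n \<sigma> \<epsilon> w ! p) = (\<Prod>p<n. \<epsilon> p) * (\<Prod>p<n. w ! p)"
proof -
  have "(\<Prod>p<n. word_act n \<sigma> \<epsilon> w ! p) = (\<Prod>p<n. \<epsilon> p) * (\<Prod>p<n. w ! \<sigma> p)"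
    by (simp add: word_act_nth prod.distrib)
  also have "(\<Prod>p<n. w ! \<sigma> p) = (\<Prod>p<n. w ! p)"
    using prod.permute[OF assms, of "(!) w"] by (simp add: o_def)
  finally show ?thesis .
qed

lemma root_words_D:
  assumes n: "n \<ge> 2"
  shows "root_words (general_linear_group n) (weyl_gen n (simple_root_D n)) n
    (even_signed_words n) (top_word n) (word_mat n) (act_D n) (pos_roots_D n) (simple_D n) (refl_root_D n)
    (\<lambda>w r. root_val w r < 0)"
proof -
  interpret group "general_linear_group n" by (rule general_linear_group_is_group)
  obtain l where l: "n = Suc (Suc l)" using n by (metis Suc_le_D numeral_2_eq_2 Suc_le_mono)
  have sq: "weyl_gen n (simple_root_D n) i * weyl_gen n (simple_root_D n) i = 1\<^sub>m n" if "i \<in> {1..n}" for i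
    using that unfolding weyl_gen_D[OF that n]
    by (auto intro!: monomial_mat_square simp: transpose_def l)
  have val: "root_val (act_D n i w) r = root_val w (refl_root_D n i r)"
    if "i \<in> {1..n}" "r \<in> pos_roots_D n - {simple_D n i}" for i w r
  proof (cases "i < n")
    case True
    then show ?thesis using that swap_root(4)[of i n r w] pos_roots_D_subset[of n]
      by (auto simp: act_D_def refl_root_D_def simple_D_def)
  next
    case False
    then show ?thesis using that
      by (cases r) (auto simp: l act_D_def refl_root_D_def simple_D_def root_val_def pos_roots_D_def
          word_act_nth transpose_def less_Suc_eq split: if_splits)
  qed
  have root_val_simple: "root_val (act_D n i w) (simple_D n i) = - root_val w (simple_D n i)"
    if "i \<in> {1..n}" for i w
    using that n by (auto simp: l act_D_def simple_D_def root_val_def word_act_nth transpose_def)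
  have perm: "transpose (i - 1) i permutes {..<n}" if "i < n" for i
    using that by (intro permutes_swap_id) auto
  have perm': "transpose (n - 2) (n - 1) permutes {..<n}"
    using n by (intro permutes_swap_id) auto
  have sign: "(\<Prod>p<n. if p = n - 2 \<or> p = n - 1 then - 1 else 1) = (1 :: real)"
    by (simp add: l)
  show ?thesis
  proof (unfold_locales, goal_cases)
    case (1 i)
    then show ?case using sq[OF 1] n
      by (intro involution_in_general_linear_group) (simp_all add: weyl_gen_D monomial_mat_carrier)
  next
    case (2 i)
    then show ?case using sq[OF 2] by (simp add: general_linear_group_simps)
  next
    case 3
    then show ?case using top_word_signed[of n]
      by (auto simp: even_signed_words_def top_word_def intro!: prod_pos)
  next
    case 4
    then show ?case by (simp add: general_linear_group_simps word_mat_top_word)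
  next
    case 5
    then show ?case by (rule inj_on_subset[OF word_mat_inj]) (auto simp: even_signed_words_def)
  next
    case (6 i w)
    then have w: "w \<in> signed_words n" by (simp add: even_signed_words_def)
    show ?case
      using 6 word_act_closed[OF w perm] word_act_closed[OF w perm'] perm perm' sign
      by (simp add: act_D_def even_signed_words_def prod_word_act)
  next
    case (7 i w)
    then show ?case using length_signed_word[of w n]
      by (auto simp: act_D_def even_signed_words_def transpose_def l intro!: word_act_word_act)
  next
    case (8 i w)
    then have w: "w \<in> signed_words n" by (simp add: even_signed_words_def)
    show ?case
      using 8 word_mat_act[OF w perm] word_mat_act[OF w perm'] n
      by (simp add: act_D_def weyl_gen_D general_linear_group_simps)
  next
    case 9
    then show ?case by (rule finite_subset[OF pos_roots_D_subset finite_pos_roots_B])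
  next
    case (10 i)
    then show ?case using n by (auto simp: simple_D_def pos_roots_D_def)
  next
    case (11 i r)
    show ?case
    proof (cases "i < n")
      case True
      then show ?thesis using 11 swap_root(1,2)[of i n r] pos_roots_D_subset[of n]
        by (auto simp: refl_root_D_def simple_D_def)
    next
      case False
      obtain p q e where "r = (p, q, e)" by (cases r)
      with 11 False show ?thesis by (simp add: l refl_root_D_def simple_D_def pos_roots_D_def)
    qed
  next
    case (12 i r)
    show ?case
    proof (cases "i < n")
      case True
      then show ?thesis using 12 swap_root(3)[of i n r] pos_roots_D_subset[of n]
        by (auto simp: refl_root_D_def simple_D_def)
    next
      case False
      obtain p q e where "r = (p, q, e)" by (cases r)
      with 12 False show ?thesis by (simp add: l refl_root_D_def simple_D_def pos_roots_D_def)
    qed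
  next
    case (13 i w r)
    then show ?case by (simp add: val)
  next
    case (14 i w)
    then have "root_val w (simple_D n i) \<noteq> 0"
      using n by (intro root_val_neq_0) (auto simp: even_signed_words_def simple_D_def pos_roots_B_def)
    with 14 show ?case by (auto simp: root_val_simple)
  next
    case (15 r)
    then show ?case using top_word_pos[of r n] pos_roots_D_subset[of n] by fastforce
  next
    case (16 w)
    then have w: "w \<in> signed_words n" and prod: "0 < (\<Prod>p<n. w ! p)" by (auto simp: even_signed_words_def)
    note len = length_signed_word[OF w]
    have dec: "w ! Suc p \<le> w ! p" if "Suc p < n" for p
      using 16(2)[of "Suc p"] that by (simp add: simple_D_def root_val_def)
    have "0 \<le> w ! l + w ! Suc l"
      using 16(2)[of n] by (simp add: l simple_D_def root_val_def)
    with dec[of l] have abs: "\<bar>w ! Suc l\<bar> \<le> w ! l" by (simp add: l)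
    \<comment> \<open>Making the last letter positive reduces to the type B criterion, which yields
      \<open>top_word\<close>. All letters before the last are then positive, and the positive
      product forces the last letter of \<open>w\<close> to be positive too.\<close>
    define w' where "w' = word_act n id (\<lambda>k. if k = Suc l then sgn (w ! Suc l) else 1) w"
    have nth: "w' ! p = (if p = Suc l then \<bar>w ! Suc l\<bar> else w ! p)" if "p < n" for p
      using that by (simp add: w'_def word_act_nth abs_sgn)
    have "w' \<in> signed_words n"
      using signed_word_nth(2)[OF w, of "Suc l"] unfolding w'_def
      by (intro word_act_closed w permutes_id) (auto simp: l abs_sgn_eq_1)
    then have top: "w' = top_word n"
    proof (rule decreasing_word_unique)
      fix p assume "Suc p < n"
      then show "w' ! Suc p \<le> w' ! p" using dec[of p] abs by (auto simp: nth l)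
    next
      fix p assume "Suc p = n"
      then show "0 \<le> w' ! p" by (auto simp: nth l)
    qed
    have "0 < w ! p" if "p < Suc l" for p
      using nth[of p] that by (simp add: l top top_word_def del: upt_Suc)
    then have "0 < (\<Prod>p<Suc l. w ! p)" by (intro prod_pos) auto
    moreover have "0 < (\<Prod>p<Suc l. w ! p) * w ! Suc l" using prod by (simp only: l prod.lessThan_Suc)
    ultimately have "0 < w ! Suc l" by (simp only: zero_less_mult_pos)
    then have "w' = w" using len
      by (intro nth_equalityI) (auto simp: nth, simp_all add: w'_def word_act_def)
    with top show ?case by simp
  qed
qed

section \<open>The highest root of type B\<close>

lemma weyl_group_conv: "weyl_group n \<alpha> = subgroup_generated (general_linear_group n) (weyl_gen n \<alpha> ` {1..n})"
proof -
  have "(\<lambda>i. reflection_mat n (\<alpha> i)) ` {1..n} = weyl_gen n \<alpha> ` {1..n}"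
    by (intro image_cong) (auto simp: weyl_gen_def)
  then show ?thesis by (simp add: weyl_group_def)
qed

lemma carrier_weyl_group_B: "carrier (weyl_group n (simple_root_B n)) = word_mat n ` signed_words n"
  unfolding weyl_group_conv by (rule root_words.carrier_generated[OF root_words_B])

lemma carrier_weyl_group_D:
  "n \<ge> 2 \<Longrightarrow> carrier (weyl_group n (simple_root_D n)) = word_mat n ` even_signed_words n"
  unfolding weyl_group_conv by (rule root_words.carrier_generated[OF root_words_D])

text \<open>Covers the roots of type B: long ones for \<delta> = 1 or -1, short ones for \<delta> =
  0. The coefficients are integers so that root coefficients can be converted to
  \<open>nat\<close>.\<close>

definition two_term_vec :: "nat \<Rightarrow> int \<Rightarrow> nat \<Rightarrow> int \<Rightarrow> nat \<Rightarrow> real vec" where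
  "two_term_vec n \<epsilon> k \<delta> l = vec n (\<lambda>j. of_int (\<epsilon> * of_bool (j = k) + \<delta> * of_bool (j = l)))"

lemma mult_mat_vec_unit_diff:
  fixes A :: "real mat"
  assumes "A \<in> carrier_mat n n" "j < n" "p < n" "q < n"
  shows "(A *\<^sub>v (unit_vec n p - unit_vec n q)) $ j = A $$ (j, p) - A $$ (j, q)"
    "(A *\<^sub>v unit_vec n p) $ j = A $$ (j, p)"
proof -
  have row: "row A j \<in> carrier_vec n" using assms by auto
  have unit: "row A j \<bullet> unit_vec n r = A $$ (j, r)" if "r < n" for r
    using that assms carrier_matD[OF assms(1)] by (simp add: scalar_prod_right_unit)
  show "(A *\<^sub>v unit_vec n p) $ j = A $$ (j, p)"
    using assms carrier_matD[OF assms(1)] unit by simp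
  show "(A *\<^sub>v (unit_vec n p - unit_vec n q)) $ j = A $$ (j, p) - A $$ (j, q)"
    using assms carrier_matD[OF assms(1)] unit by (simp add: scalar_prod_minus_distrib[OF row])
qed

lemma word_mat_column:
  assumes "w \<in> signed_words n" "p < n"
  obtains k \<epsilon> where "k < n" "\<bar>w ! p\<bar> = real (n - k)" "\<epsilon> \<in> {- 1, 1}"
    "\<And>j. j < n \<Longrightarrow> word_mat n w $$ (j, p) = of_int (\<epsilon> * of_bool (j = k))"
proof -
  obtain r where r: "r \<in> {1..n}" "\<bar>w ! p\<bar> = real r" using signed_word_nth(1)[OF assms] by auto
  have ne: "w ! p \<noteq> 0" by (rule signed_word_nth(2)[OF assms])
  show thesis
  proof (rule that[of "n - r" "if 0 < w ! p then 1 else - 1"])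
    show "word_mat n w $$ (j, p) = of_int ((if 0 < w ! p then 1 else - 1) * of_bool (j = n - r))" if "j < n" for j
      using that assms(2) r ne by (auto simp: word_mat_def sgn_if)
  qed (use r in auto)
qed

lemma root_B_form:
  assumes n: "n \<ge> 2" and v: "v \<in> roots n (simple_root_B n)"
  obtains \<epsilon> k \<delta> l where "\<epsilon> \<in> {- 1, 1}" "\<delta> \<in> {- 1, 0, 1}" "k \<noteq> l" "v = two_term_vec n \<epsilon> k \<delta> l"
proof -
  obtain w i where w: "w \<in> signed_words n" and i: "i \<in> {1..n}"
    and v: "v = word_mat n w *\<^sub>v simple_root_B n i"
    using v by (auto simp: roots_def carrier_weyl_group_B)
  have A: "word_mat n w \<in> carrier_mat n n" by (simp add: word_mat_def)
  show thesis
  proof (cases "i < n")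
    case True
    then have pq: "i - 1 < n" "i < n" "i - 1 \<noteq> i" using i by auto
    obtain k \<epsilon> where k: "k < n" "\<bar>w ! (i - 1)\<bar> = real (n - k)" "\<epsilon> \<in> {- 1, 1}"
      "\<And>j. j < n \<Longrightarrow> word_mat n w $$ (j, i - 1) = of_int (\<epsilon> * of_bool (j = k))"
      using word_mat_column[OF w pq(1)] by metis
    obtain l \<delta> where l: "l < n" "\<bar>w ! i\<bar> = real (n - l)" "\<delta> \<in> {- 1, 1}"
      "\<And>j. j < n \<Longrightarrow> word_mat n w $$ (j, i) = of_int (\<delta> * of_bool (j = l))"
      using word_mat_column[OF w pq(2)] by metis
    have "v = two_term_vec n \<epsilon> k (- \<delta>) l"
    proof (rule eq_vecI)
      fix j assume "j < dim_vec (two_term_vec n \<epsilon> k (- \<delta>) l)"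
      then have j: "j < n" by (simp add: two_term_vec_def)
      have "v $ j = word_mat n w $$ (j, i - 1) - word_mat n w $$ (j, i)"
        using True mult_mat_vec_unit_diff(1)[OF A j pq(1,2)] by (simp add: v simple_root_B_def)
      then show "v $ j = two_term_vec n \<epsilon> k (- \<delta>) l $ j"
        using k(4)[OF j] l(4)[OF j] j by (simp add: two_term_vec_def)
    qed (simp add: v two_term_vec_def word_mat_def)
    moreover have "k \<noteq> l" using signed_word_nth(3)[OF w pq(1,2)] k(2) l(2) pq(3) by auto
    ultimately show thesis using that[of \<epsilon> "- \<delta>" k l] k(3) l(3) by auto
  next
    case False
    then have p: "n - 1 < n" using n by auto
    obtain k \<epsilon> where k: "k < n" "\<epsilon> \<in> {- 1, 1}"
      "\<And>j. j < n \<Longrightarrow> word_mat n w $$ (j, n - 1) = of_int (\<epsilon> * of_bool (j = k))"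
      using word_mat_column[OF w p] by metis
    \<comment> \<open>With coefficient 0, the second index only has to differ from
      \<open>k\<close>.\<close>
    have "v = two_term_vec n \<epsilon> k 0 (Suc k)"
    proof (rule eq_vecI)
      fix j assume "j < dim_vec (two_term_vec n \<epsilon> k 0 (Suc k))"
      then have j: "j < n" by (simp add: two_term_vec_def)
      have "v $ j = word_mat n w $$ (j, n - 1)"
        using False mult_mat_vec_unit_diff(2)[OF A j p p] by (simp add: v simple_root_B_def)
      then show "v $ j = two_term_vec n \<epsilon> k 0 (Suc k) $ j"
        using k(3)[OF j] j by (simp add: two_term_vec_def)
    qed (simp add: v two_term_vec_def word_mat_def)
    then show thesis using that[of \<epsilon> 0 k "Suc k"] k(2) by auto
  qed
qed

text \<open>Only simple roots j and j + 1 touch coordinate j, with entries -1 and 1. So coefficients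
  are partial sums of coordinates.\<close>

lemma sum_simple_root_B:
  assumes "j < n"
  shows "(\<Sum>i\<in>{1..n}. f i * simple_root_B n i $ j) = f (Suc j) - (if j = 0 then 0 else f j)"
proof -
  have "(\<Sum>i\<in>{1..n}. f i * simple_root_B n i $ j)
    = (\<Sum>i\<in>{1..n}. (if i = Suc j then f i else 0) - (if i = j then f i else 0))"
  proof (intro sum.cong refl)
    fix i assume "i \<in> {1..n}"
    then obtain i' where i: "i = Suc i'" "i' < n" by (cases i) auto
    have "simple_root_B n i $ j = (if i' = j then 1 else 0) - (if i = j then 1 else 0)"
    proof (cases "i < n")
      case True
      then show ?thesis using i assms by (simp add: simple_root_B_def)
    next
      case False
      then have "n - 1 = i'" "i \<noteq> j" using i assms by auto
      then have "simple_root_B n i = unit_vec n i'" using False by (simp add: simple_root_B_def)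
      then show ?thesis using \<open>i \<noteq> j\<close> i(2) assms by auto
    qed
    then show "f i * simple_root_B n i $ j = (if i = Suc j then f i else 0) - (if i = j then f i else 0)"
      using i by simp
  qed
  also have "\<dots> = f (Suc j) - (if j = 0 then 0 else f j)"
    using assms by (auto simp: sum_subtractf)
  finally show ?thesis .
qed

lemma root_le_highest_B:
  assumes "\<epsilon> \<in> {- 1, 1}" "\<delta> \<in> {- 1, 0, 1}" "k \<noteq> l"
  shows "root_le n (simple_root_B n) (two_term_vec n \<epsilon> k \<delta> l) (two_term_vec n 1 0 1 1)"
proof -
  \<comment> \<open>\<open>P i\<close> sums the first i coordinates of the difference, hence is the
    coefficient of simple root i. It is nonnegative: from i = 2 on the highest root contributes 2,
    and at i = 1 it contributes 1 while at most one of \<open>k\<close> and \<open>l\<close> is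
    0.\<close>
  define P where "P i = of_bool (0 < i) + of_bool (1 < i) - \<epsilon> * of_bool (k < i) - \<delta> * of_bool (l < i)" for i :: nat
  have "0 \<le> P i" for i
  proof (cases "i \<le> 1")
    case True
    then show ?thesis using assms by (auto simp: P_def)
  next
    case False
    then show ?thesis using assms by (auto simp: P_def)
  qed
  then have c: "of_nat (nat (P i)) = (of_int (P i) :: real)" for i by simp
  have "two_term_vec n 1 0 1 1 $ j - two_term_vec n \<epsilon> k \<delta> l $ j
      = (\<Sum>i\<in>{1..n}. of_nat (nat (P i)) * simple_root_B n i $ j)" if "j < n" for j
  proof -
    have P: "P (Suc j) - (if j = 0 then 0 else P j)
      = (of_bool (j = 0) + of_bool (j = 1)) - (\<epsilon> * of_bool (j = k) + \<delta> * of_bool (j = l))"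
      by (auto simp: P_def less_Suc_eq)
    have "two_term_vec n 1 0 1 1 $ j - two_term_vec n \<epsilon> k \<delta> l $ j
      = of_int ((of_bool (j = 0) + of_bool (j = 1)) - (\<epsilon> * of_bool (j = k) + \<delta> * of_bool (j = l)))"
      using that by (simp add: two_term_vec_def)
    then show ?thesis
      unfolding sum_simple_root_B[OF that] c P[symmetric] by simp
  qed
  then show ?thesis unfolding root_le_def by (intro exI[of _ "\<lambda>i. nat (P i)"]) blast
qed

text \<open>Provides the uniqueness of the highest root. Adding the two expansions gives c + d = 0
  one coordinate after the other, and both are natural numbers.\<close>

lemma root_le_B_antisym:
  assumes "root_le n (simple_root_B n) u v" "root_le n (simple_root_B n) v u" "dim_vec u = n" "dim_vec v = n"
  shows "u = v"
proof -
  obtain c :: "nat \<Rightarrow> nat" where c: "\<And>j. j < n \<Longrightarrow> v $ j - u $ j = of_nat (c (Suc j)) - (if j = 0 then 0 else of_nat (c j))"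
    using assms(1) sum_simple_root_B by (auto simp: root_le_def)
  obtain d :: "nat \<Rightarrow> nat" where d: "\<And>j. j < n \<Longrightarrow> u $ j - v $ j = of_nat (d (Suc j)) - (if j = 0 then 0 else of_nat (d j))"
    using assms(2) sum_simple_root_B by (auto simp: root_le_def)
  have z: "c (Suc j) = 0 \<and> d (Suc j) = 0" if "j < n" for j
    using that
  proof (induction j)
    case 0
    have "real (c (Suc 0)) + real (d (Suc 0)) = 0" using c[OF 0] d[OF 0] by simp
    then show ?case by simp
  next
    case (Suc j)
    have "real (c (Suc (Suc j))) + real (d (Suc (Suc j))) = 0"
      using c[OF Suc.prems] d[OF Suc.prems] Suc by simp
    then show ?case by simp
  qed
  show ?thesis
  proof (rule eq_vecI)
    fix j assume "j < dim_vec v"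
    then have j: "j < n" using assms by simp
    then show "u $ j = v $ j" using c[OF j] z[OF j] z[of "j - 1"] by (cases j) auto
  qed (use assms in simp)
qed

lemma highest_root_B:
  assumes n: "n \<ge> 2"
  shows "highest_root n (simple_root_B n) = two_term_vec n 1 0 1 1"
  unfolding highest_root_def
proof (rule the_equality)
  let ?\<theta> = "two_term_vec n 1 0 1 1"
  have le: "\<forall>\<beta>\<in>roots n (simple_root_B n). root_le n (simple_root_B n) \<beta> ?\<theta>"
    using root_B_form[OF n] root_le_highest_B by metis
  have mem: "?\<theta> \<in> roots n (simple_root_B n)"
  proof -
    \<comment> \<open>Negating the second coordinate takes e_1 - e_2 to e_1 + e_2.\<close>
    define \<epsilon> :: "nat \<Rightarrow> real" where "\<epsilon> = (\<lambda>k. if k = 1 then - 1 else 1)"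
    have "word_act n id \<epsilon> (top_word n) \<in> signed_words n"
      by (intro word_act_closed top_word_signed permutes_id) (simp add: \<epsilon>_def)
    moreover have "word_mat n (word_act n id \<epsilon> (top_word n)) = monomial_mat n id \<epsilon>"
      by (subst word_mat_act[OF top_word_signed permutes_id])
        (simp_all add: \<epsilon>_def word_mat_top_word left_mult_one_mat[OF monomial_mat_carrier])
    ultimately have "monomial_mat n id \<epsilon> \<in> carrier (weyl_group n (simple_root_B n))"
      unfolding carrier_weyl_group_B by (metis imageI)
    moreover have "?\<theta> = monomial_mat n id \<epsilon> *\<^sub>v simple_root_B n 1"
    proof (rule eq_vecI)
      fix j assume "j < dim_vec (monomial_mat n id \<epsilon> *\<^sub>v simple_root_B n 1)"
      then have j: "j < n" by (simp add: monomial_mat_def)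
      have "(monomial_mat n id \<epsilon> *\<^sub>v simple_root_B n 1) $ j = monomial_mat n id \<epsilon> $$ (j, 0) - monomial_mat n id \<epsilon> $$ (j, 1)"
        using mult_mat_vec_unit_diff(1)[OF monomial_mat_carrier j, of 0 1 id \<epsilon>] n by (simp add: simple_root_B_def)
      also have "\<dots> = ?\<theta> $ j" using j n by (auto simp: monomial_mat_def \<epsilon>_def two_term_vec_def)
      finally show "?\<theta> $ j = (monomial_mat n id \<epsilon> *\<^sub>v simple_root_B n 1) $ j" by simp
    qed (simp add: two_term_vec_def monomial_mat_def)
    ultimately show ?thesis unfolding roots_def using n
      by (intro CollectI exI[of _ "monomial_mat n id \<epsilon>"] exI[of _ 1]) auto
  qed
  show "?\<theta> \<in> roots n (simple_root_B n) \<and> (\<forall>\<beta>\<in>roots n (simple_root_B n). root_le n (simple_root_B n) \<beta> ?\<theta>)"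
    using le mem by simp
  fix \<theta> assume \<theta>: "\<theta> \<in> roots n (simple_root_B n) \<and> (\<forall>\<beta>\<in>roots n (simple_root_B n). root_le n (simple_root_B n) \<beta> \<theta>)"
  have "dim_vec \<theta> = n" using root_B_form[OF n, of \<theta>] \<theta> by (metis dim_vec two_term_vec_def)
  then show "\<theta> = ?\<theta>" using \<theta> le mem by (intro root_le_B_antisym) (auto simp: two_term_vec_def)
qed

section \<open>The affine descent at 0\<close>

definition act_0 :: "nat \<Rightarrow> real list \<Rightarrow> real list" where
  "act_0 n = word_act n (transpose 0 1) (\<lambda>k. if k = 0 \<or> k = 1 then - 1 else 1)"

lemma weyl_gen_B_0:
  assumes "n \<ge> 2"
  shows "weyl_gen n (simple_root_B n) 0 = monomial_mat n (transpose 0 1) (\<lambda>k. if k = 0 \<or> k = 1 then - 1 else 1)"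
proof -
  have "two_term_vec n 1 0 1 1 = unit_vec n 0 + unit_vec n 1"
    using assms by (intro eq_vecI) (auto simp: two_term_vec_def)
  then show ?thesis using assms by (simp add: weyl_gen_def highest_root_B reflection_mat_plus)
qed

text \<open>
  The reflection in \<open>\<theta>\<close> subtracts from a positive root a nonnegative multiple of \<open>\<theta>\<close>, hence the
  inversion sets before and after it are comparable.
\<close>

lemma root_val_act_0:
  assumes "n \<ge> 2" "r \<in> pos_roots_B n"
  shows "0 \<le> w ! 0 + w ! 1 \<Longrightarrow> root_val (act_0 n w) r \<le> root_val w r"
    and "w ! 0 + w ! 1 \<le> 0 \<Longrightarrow> root_val w r \<le> root_val (act_0 n w) r"
proof -
  obtain p q e where r: "r = (p, q, e)" by (cases r)
  show "0 \<le> w ! 0 + w ! 1 \<Longrightarrow> root_val (act_0 n w) r \<le> root_val w r"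
    using assms by (auto simp: r root_val_def act_0_def word_act_nth transpose_def pos_roots_B_def)
  show "w ! 0 + w ! 1 \<le> 0 \<Longrightarrow> root_val w r \<le> root_val (act_0 n w) r"
    using assms by (auto simp: r root_val_def act_0_def word_act_nth transpose_def pos_roots_B_def)
qed

lemma affine_descents_B:
  assumes n: "n \<ge> 2" and w: "w \<in> signed_words n"
  shows "affine_descents (weyl_group n (simple_root_B n)) (weyl_gen n (simple_root_B n)) n (word_mat n w)
    = (if 0 < w ! 0 + w ! 1 then {0} else {}) \<union> {i \<in> {1..n}. root_val w (simple_B n i) < 0}"
proof -
  interpret root_words "general_linear_group n" "weyl_gen n (simple_root_B n)" n
    "signed_words n" "top_word n" "word_mat n" "act_B n" "pos_roots_B n" "simple_B n" "refl_root_B n"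
    "\<lambda>w r. root_val w r < 0"
    by (rule root_words_B)
  have perm: "transpose 0 1 permutes {..<n}" using n by (intro permutes_swap_id) auto
  have act: "act_0 n w \<in> signed_words n"
    "word_mat n (act_0 n w) = word_mat n w * weyl_gen n (simple_root_B n) 0"
    unfolding act_0_def weyl_gen_B_0[OF n] using w perm
    by (auto intro!: word_act_closed[of w n, simplified] word_mat_act[of w n, simplified])
  have \<theta>: "(0, 1, True) \<in> pos_roots_B n" using n by (simp add: pos_roots_B_def)
  have v\<theta>: "root_val w (0, 1, True) = w ! 0 + w ! 1" "root_val (act_0 n w) (0, 1, True) = - (w ! 0 + w ! 1)"
    using n by (simp_all add: root_val_def act_0_def word_act_nth)
  \<comment> \<open>The reflection in the highest root is not a simple one and may change the length
    by more than 1. Nested inversion sets still decide the direction, and the highest root itself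
    makes the inclusion strict when its value is positive.\<close>
  have "card (inversions w) < card (inversions (act_0 n w)) \<longleftrightarrow> 0 < w ! 0 + w ! 1"
  proof (cases "0 < w ! 0 + w ! 1")
    case True
    have "inversions w \<subset> inversions (act_0 n w)"
    proof (rule psubsetI)
      show "inversions w \<subseteq> inversions (act_0 n w)"
        using root_val_act_0(1)[OF n, of _ w] True by (fastforce simp: inversions_def)
      have "(0, 1, True) \<in> inversions (act_0 n w)" "(0, 1, True) \<notin> inversions w"
        unfolding inversions_def using \<theta> v\<theta> True by auto
      then show "inversions w \<noteq> inversions (act_0 n w)" by blast
    qed
    then show ?thesis using True psubset_card_mono[OF finite_inversions] by simp
  next
    case False
    have "inversions (act_0 n w) \<subseteq> inversions w"
      using root_val_act_0(2)[OF n, of _ w] False by (fastforce simp: inversions_def)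
    then show ?thesis using False card_mono[OF finite_inversions] by (simp add: leD)
  qed
  then have "coxeter_length (general_linear_group n) (weyl_gen n (simple_root_B n)) n (word_mat n w)
      < coxeter_length (general_linear_group n) (weyl_gen n (simple_root_B n)) n
          (word_mat n w \<otimes>\<^bsub>general_linear_group n\<^esub> weyl_gen n (simple_root_B n) 0)
    \<longleftrightarrow> 0 < w ! 0 + w ! 1"
    using coxeter_length_model[OF w] coxeter_length_model[OF act(1)] act(2)
    by (simp add: general_linear_group_simps)
  then show ?thesis
    unfolding weyl_group_conv affine_descents_subgroup_generated affine_descents_def descents_model[OF w]
    by auto
qed

section \<open>Both polynomials as sums over words\<close>

lemma card_simple_B_neg:
  assumes "n \<ge> 1" "length w = n"
  shows "card {i \<in> {1..n}. root_val w (simple_B n i) < 0} = ascents w + of_bool (last w < 0)"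
proof -
  have last: "last w = w ! (n - 1)" using assms by (subst last_conv_nth) auto
  have "{i \<in> {1..n}. root_val w (simple_B n i) < 0}
    = Suc ` {i. Suc i < length w \<and> w ! i < w ! Suc i} \<union> (if last w < 0 then {n} else {})"
  proof (rule Set.set_eqI)
    fix i
    show "i \<in> {i \<in> {1..n}. root_val w (simple_B n i) < 0} \<longleftrightarrow>
      i \<in> Suc ` {i. Suc i < length w \<and> w ! i < w ! Suc i} \<union> (if last w < 0 then {n} else {})"
      using assms by (cases i) (auto simp: simple_B_def root_val_def last)
  qed
  moreover have "finite {i. Suc i < length w \<and> w ! i < w ! Suc i}"
    by (rule finite_subset[of _ "{..<length w}"]) auto
  ultimately show ?thesis using assms
    by (subst ascents_conv_card, subst card_image[symmetric, of Suc]) (auto simp: card_insert_if)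
qed

lemma card_simple_D_neg:
  assumes "n \<ge> 2" "length w = n"
  shows "card {i \<in> {1..n}. root_val w (simple_D n i) < 0} = ascents w + of_bool (w ! (n - 2) + w ! (n - 1) < 0)"
proof -
  have "{i \<in> {1..n}. root_val w (simple_D n i) < 0}
    = Suc ` {i. Suc i < length w \<and> w ! i < w ! Suc i} \<union> (if w ! (n - 2) + w ! (n - 1) < 0 then {n} else {})"
  proof (rule Set.set_eqI)
    fix i
    show "i \<in> {i \<in> {1..n}. root_val w (simple_D n i) < 0} \<longleftrightarrow>
      i \<in> Suc ` {i. Suc i < length w \<and> w ! i < w ! Suc i} \<union> (if w ! (n - 2) + w ! (n - 1) < 0 then {n} else {})"
      using assms by (cases i) (auto simp: simple_D_def root_val_def)
  qed
  moreover have "finite {i. Suc i < length w \<and> w ! i < w ! Suc i}"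
    by (rule finite_subset[of _ "{..<length w}"]) auto
  ultimately show ?thesis using assms
    by (subst ascents_conv_card, subst card_image[symmetric, of Suc]) (auto simp: card_insert_if)
qed

lemma poly_affine_eulerian_B:
  assumes n: "n \<ge> 2"
  shows "poly (affine_eulerian_B n) y
    = (\<Sum>w\<in>signed_words n. y ^ (ascents w + of_bool (0 < w ! 0 + w ! 1) + of_bool (last w < 0)) :: 'a::field_char_0)"
proof -
  have "card (affine_descents (weyl_group n (simple_root_B n)) (weyl_gen n (simple_root_B n)) n (word_mat n w))
    = ascents w + of_bool (0 < w ! 0 + w ! 1) + of_bool (last w < 0)" if w: "w \<in> signed_words n" for w
  proof -
    have "card {i \<in> {1..n}. root_val w (simple_B n i) < 0} = ascents w + of_bool (last w < 0)"
      using n length_signed_word[OF w] by (intro card_simple_B_neg) auto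
    then show ?thesis unfolding affine_descents_B[OF n w] by (subst card_Un_disjoint) auto
  qed
  then show ?thesis
    unfolding affine_eulerian_B_def affine_eulerian_poly_def carrier_weyl_group_B
    by (subst sum.reindex[OF word_mat_inj]) (simp add: poly_sum poly_monom)
qed

lemma poly_eulerian_D:
  assumes n: "n \<ge> 2"
  shows "poly (eulerian_D n) y
    = (\<Sum>w\<in>even_signed_words n. y ^ (ascents w + of_bool (w ! (n - 2) + w ! (n - 1) < 0)) :: 'a::field_char_0)"
proof -
  interpret root_words "general_linear_group n" "weyl_gen n (simple_root_D n)" n
    "even_signed_words n" "top_word n" "word_mat n" "act_D n" "pos_roots_D n" "simple_D n" "refl_root_D n"
    "\<lambda>w r. root_val w r < 0"
    by (rule root_words_D[OF n])
  have "card (descents (weyl_group n (simple_root_D n)) (weyl_gen n (simple_root_D n)) n (word_mat n w))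
    = ascents w + of_bool (w ! (n - 2) + w ! (n - 1) < 0)" if w: "w \<in> even_signed_words n" for w
  proof -
    have "length w = n" using w length_signed_word by (auto simp: even_signed_words_def)
    then show ?thesis
      unfolding weyl_group_conv descents_subgroup_generated descents_model[OF w]
      by (rule card_simple_D_neg[OF n])
  qed
  then show ?thesis
    unfolding eulerian_D_def eulerian_poly_def carrier_weyl_group_D[OF n]
    by (subst sum.reindex[OF model_inj]) (simp add: poly_sum poly_monom)
qed

section \<open>Doubling the type D sum\<close>

definition flip_unit :: "nat \<Rightarrow> real list \<Rightarrow> real list" where
  "flip_unit n w = word_act n id (\<lambda>p. if \<bar>w ! p\<bar> = 1 then - 1 else 1) w"

lemma flip_unit_closed: "w \<in> signed_words n \<Longrightarrow> flip_unit n w \<in> signed_words n"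
  unfolding flip_unit_def by (intro word_act_closed permutes_id) auto

lemma flip_unit_nth: "p < n \<Longrightarrow> flip_unit n w ! p = (if \<bar>w ! p\<bar> = 1 then - w ! p else w ! p)"
  by (simp add: flip_unit_def word_act_nth)

lemma flip_unit_flip_unit: "w \<in> signed_words n \<Longrightarrow> flip_unit n (flip_unit n w) = w"
  by (rule nth_equalityI)
    (auto simp: length_signed_word flip_unit_nth, simp_all add: flip_unit_def word_act_def)

text \<open>Next to a letter 1 or -1, the other letter has absolute value at least 2 and alone
  decides the comparison and the sign of the sum.\<close>

lemma flip_unit_compare:
  assumes w: "w \<in> signed_words n" and pq: "p < n" "q < n" "p \<noteq> q"
  shows "flip_unit n w ! p < flip_unit n w ! q \<longleftrightarrow> w ! p < w ! q"
    and "flip_unit n w ! p + flip_unit n w ! q < 0 \<longleftrightarrow> w ! p + w ! q < 0"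
proof -
  obtain k l where kl: "k \<ge> 1" "l \<ge> 1" "\<bar>w ! p\<bar> = real k" "\<bar>w ! q\<bar> = real l"
    using signed_word_nth(1)[OF w pq(1)] signed_word_nth(1)[OF w pq(2)] by auto
  have "k \<noteq> l" using signed_word_nth(3)[OF w pq(1,2)] kl pq(3) by auto
  then consider "\<bar>w ! p\<bar> = 1" "\<bar>w ! q\<bar> \<ge> 2" | "\<bar>w ! q\<bar> = 1" "\<bar>w ! p\<bar> \<ge> 2" | "\<bar>w ! p\<bar> \<ge> 2" "\<bar>w ! q\<bar> \<ge> 2"
    using kl by (cases "k = 1"; cases "l = 1") auto
  then have "(flip_unit n w ! p < flip_unit n w ! q \<longleftrightarrow> w ! p < w ! q) \<and>
    (flip_unit n w ! p + flip_unit n w ! q < 0 \<longleftrightarrow> w ! p + w ! q < 0)"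
    unfolding flip_unit_nth[OF pq(1)] flip_unit_nth[OF pq(2)] by cases auto
  then show "flip_unit n w ! p < flip_unit n w ! q \<longleftrightarrow> w ! p < w ! q"
    "flip_unit n w ! p + flip_unit n w ! q < 0 \<longleftrightarrow> w ! p + w ! q < 0" by auto
qed

lemma prod_flip_unit:
  assumes w: "w \<in> signed_words n" and n: "n \<ge> 1"
  shows "(\<Prod>p<n. flip_unit n w ! p) = - (\<Prod>p<n. w ! p)"
proof -
  have "1 \<in> real ` {1..n}" using n by (intro image_eqI[of _ _ 1]) auto
  then have "1 \<in> abs ` set w" using w by (simp add: keyed_lists_def)
  then obtain r where r: "r < n" "\<bar>w ! r\<bar> = 1"
    using length_signed_word[OF w] by (auto simp: in_set_conv_nth)
  have "(\<Prod>p<n. if \<bar>w ! p\<bar> = 1 then - 1 else (1 :: real)) = (\<Prod>p<n. if p = r then - 1 else 1)"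
    using signed_word_nth(3)[OF w _ r(1)] r(2) by (intro prod.cong) auto
  also have "\<dots> = - 1" using r by simp
  finally show ?thesis
    unfolding flip_unit_def prod_word_act[OF permutes_id] by simp
qed

text \<open>Exactly one letter has absolute value 1, so flipping its sign pairs even words with odd
  ones.\<close>

lemma sum_even_signed_words:
  fixes f :: "real list \<Rightarrow> 'a::comm_ring_1"
  assumes n: "n \<ge> 1" and f: "\<And>w. w \<in> signed_words n \<Longrightarrow> f (flip_unit n w) = f w"
  shows "(\<Sum>w\<in>signed_words n. f w) = 2 * (\<Sum>w\<in>even_signed_words n. f w)"
proof -
  define odd where "odd = {w \<in> signed_words n. (\<Prod>p<n. w ! p) < 0}"
  have fin: "finite (signed_words n)" by (intro finite_keyed_lists_abs) auto
  have "0 < (\<Prod>p<n. w ! p) \<or> (\<Prod>p<n. w ! p) < 0" if "w \<in> signed_words n" for w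
  proof -
    have "(\<Prod>p<n. w ! p) \<noteq> 0" using signed_word_nth(2)[OF that] by simp
    then show ?thesis by linarith
  qed
  then have un: "signed_words n = even_signed_words n \<union> odd"
    unfolding even_signed_words_def odd_def by blast
  have odd: "flip_unit n w \<in> even_signed_words n" "flip_unit n (flip_unit n w) = w" "f (flip_unit n w) = f w"
    if "w \<in> odd" for w
    using that flip_unit_closed[of w n] flip_unit_flip_unit[of w n] prod_flip_unit[of w n] n f[of w]
    by (simp_all add: odd_def even_signed_words_def)
  have even: "flip_unit n w \<in> odd" "flip_unit n (flip_unit n w) = w" if "w \<in> even_signed_words n" for w
    using that flip_unit_closed[of w n] flip_unit_flip_unit[of w n] prod_flip_unit[of w n] n
    by (simp_all add: odd_def even_signed_words_def)
  have "(\<Sum>w\<in>odd. f w) = (\<Sum>w\<in>even_signed_words n. f w)"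
    by (rule sum.reindex_bij_witness[where i = "flip_unit n" and j = "flip_unit n"]) (simp_all add: odd even)
  moreover have "(\<Sum>w\<in>signed_words n. f w) = (\<Sum>w\<in>even_signed_words n. f w) + (\<Sum>w\<in>odd. f w)"
    using fin un by (subst un, intro sum.union_disjoint)
      (auto simp: even_signed_words_def odd_def elim: finite_subset[rotated])
  ultimately show ?thesis by simp
qed

lemma poly_eulerian_D_signed:
  assumes n: "n \<ge> 2"
  shows "2 * poly (eulerian_D n) y
    = (\<Sum>w\<in>signed_words n. y ^ (ascents w + of_bool (0 < w ! 0 + w ! 1)) :: 'a::field_char_0)"
proof -
  define f where "f w = y ^ (ascents w + of_bool (w ! (n - 2) + w ! (n - 1) < 0))" for w :: "real list"
  have "f (flip_unit n w) = f w" if w: "w \<in> signed_words n" for w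
  proof -
    have len: "length w = n" "length (flip_unit n w) = n"
      using length_signed_word w flip_unit_closed by blast+
    have "{i. Suc i < n \<and> flip_unit n w ! i < flip_unit n w ! Suc i} = {i. Suc i < n \<and> w ! i < w ! Suc i}"
      using flip_unit_compare(1)[OF w] by auto
    then have "ascents (flip_unit n w) = ascents w" by (simp only: ascents_conv_card len)
    moreover have "n - 2 < n" "n - 1 < n" "n - 2 \<noteq> n - 1" using n by auto
    note flip_unit_compare(2)[OF w this]
    ultimately show ?thesis by (simp only: f_def)
  qed
  then have "2 * poly (eulerian_D n) y = (\<Sum>w\<in>signed_words n. f w)"
    unfolding poly_eulerian_D[OF n] f_def[symmetric] using n by (intro sum_even_signed_words[symmetric]) auto
  \<comment> \<open>Moves the condition from the last two letters to the first two, where the affine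
    descent at 0 of type B sits.\<close>
  also have "\<dots> = (\<Sum>w\<in>signed_words n. f (map uminus (rev w)))"
    by (rule sum_keyed_lists_abs_rev_uminus[symmetric])
  also have "\<dots> = (\<Sum>w\<in>signed_words n. y ^ (ascents w + of_bool (0 < w ! 0 + w ! 1)))"
  proof (intro sum.cong refl)
    fix w assume w: "w \<in> signed_words n"
    have "map uminus (rev w) ! (n - 2) = - w ! 1" "map uminus (rev w) ! (n - 1) = - w ! 0"
      using n length_signed_word[OF w] by (simp_all add: rev_nth)
    then have "map uminus (rev w) ! (n - 2) + map uminus (rev w) ! (n - 1) < 0 \<longleftrightarrow> 0 < w ! 0 + w ! 1"
      by linarith
    then show "f (map uminus (rev w)) = y ^ (ascents w + of_bool (0 < w ! 0 + w ! 1))"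
      by (simp only: f_def ascents_map_uminus_rev)
  qed
  finally show ?thesis .
qed

theorem theorem3p1:
  fixes n :: nat and x :: "'a::field_char_0"
  assumes "n \<ge> 2" and "x \<noteq> 0"
  shows "(x + 1) ^ (n + 1) * poly (eulerian_A (n - 1)) x
           - of_nat n * x * (x + 1) ^ n * poly (eulerian_A (n - 2)) x
         = poly (eulerian_D n) (x\<^sup>2) + 1 / (2 * x) * poly (affine_eulerian_B n) (x\<^sup>2)"
proof -
  obtain l where l: "n = Suc (Suc l)" using assms(1) by (metis Suc_le_D numeral_2_eq_2 Suc_le_mono)
  define G where "G m = (x + 1) ^ Suc m * poly (eulerian_rec m) x" for m
  \<comment> \<open>Multiplying the right-hand side by 2x clears the denominator and supplies the
    factor 2 for the doubled type D sum.\<close>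
  have "x * (2 * poly (eulerian_D n) (x\<^sup>2)) + poly (affine_eulerian_B n) (x\<^sup>2)
    = (\<Sum>w\<in>signed_words n. (x\<^sup>2) ^ (ascents w + of_bool (0 < w ! 0 + w ! 1))
        * (x + (x\<^sup>2) ^ of_bool (last w < 0)))"
    unfolding poly_eulerian_D_signed[OF assms(1)] poly_affine_eulerian_B[OF assms(1)] sum_distrib_left
      sum.distrib[symmetric]
    by (intro sum.cong refl) (simp add: power_add algebra_simps)
  also have "\<dots> = 2 * (x * G n) - 2 * of_nat n * x\<^sup>2 * G (n - 1)"
    using sum_type_D_weighted[of "real ` {1..n}" x] assms(1) unfolding G_def
    by (simp add: card_image)
  also have "\<dots> = 2 * x * (G n - of_nat n * x * G (n - 1))"
    by (simp add: algebra_simps power2_eq_square)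
  finally have *: "2 * x * (poly (eulerian_D n) (x\<^sup>2) + 1 / (2 * x) * poly (affine_eulerian_B n) (x\<^sup>2))
      = 2 * x * (G n - of_nat n * x * G (n - 1))"
    using assms(2) by (simp add: algebra_simps)
  have "poly (eulerian_D n) (x\<^sup>2) + 1 / (2 * x) * poly (affine_eulerian_B n) (x\<^sup>2)
      = G n - of_nat n * x * G (n - 1)"
    using * assms(2) by (subst (asm) mult_cancel_left) simp
  then show ?thesis
    by (simp add: G_def eulerian_A_conv l mult.assoc)
qed

end
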